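(* Let $q$ be a prime power, $k\geqslant 3$, let $G$ be an arc of $\mathrm{V}_k(\mathbb{F}_q)$ with a fixed ordering, and let $n$ be an integer with $0\leqslant n\leqslant |G|-k$. Put $t=|G|-k-n$. Suppose $(G,n)$ has Property W and, if $q$ is odd, that $2n\geqslant |G|-k-1$. Fix a subset $E\subseteq G$ of size $k+t-1$ if $q$ is even and $k+2t-1$ if $q$ is odd. Then for arcs $S$ of size $q+2k+n-1-|G|$ containing $G$, the polynomial $\phi_S$ (constructed using $E$) is determined by $G$: if $S,S'$ are two such arcs then $\phi_S$ and $\phi_{S'}$ are equal up to multiplication by a non-zero scalar.
   Context: $\mathrm{V}_k(\mathbb{F}_q)$ is the $k$-dimensional vector space over $\mathbb{F}_q$; an arc is a set of vectors in which every $k$-subset is a basis. $\det(v_1,\ldots,v_k)$ is the determinant of the matrix with rows $v_i$ w.r.t. a fixed basis. The matrix $\mathrm{M}_n$ has rows indexed by $(k-1)$-subsets $C$ of $G$ and columns by pairs $(A,E')$ with $E'\subseteq G$, $|E'|=|G|-n$, $A\subseteq E'$, $|A|=k-2$; the $(C,(A,E'))$ entry is $\prod_{u\in G\setminus E'}\det(u,C)$ if $A\subset C$ and $0$ otherwise (subsets ordered as in $G$, $\det(u,C)=\det(u,p_1,\ldots,p_{k-1})$ for $C=\{p_1,\ldots,p_{k-1}\}$). $(G,n)$ has Property W if for each $(k-2)$-subset $A$ of $G$ there are $(k-1)$-subsets $C,C_1,\ldots,C_{|G|-n-k+1}$ of $G$ containing $A$ such that for each $i$ the column space of $\mathrm{M}_n$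 contains a vector whose non-zero coordinates are exactly at $C$ and $C_i$. Construction of $\phi_S$ for an arc $S$ containing $G$, with $t=q+k-1-|S|$: order $S$ so that the elements of $G$ come first, in their given order; subsets of $S$ inherit this order. For each $(k-2)$-subset $A$ of $S$ there are exactly $t$ hyperplanes meeting $S$ exactly in $A$; choose pairwise linearly independent linear forms $\alpha_1,\ldots,\alpha_t$ with $\ker\alpha_i\cap S=A$ and set $f_A(x)=\prod_{i=1}^t\alpha_i(x)$. Let $F$ be the set of the first $k-2$ elements of $S$. For a $(k-1)$-subset $C$ of $S$ let $D=C\cap F$, $C\setminus F=\{x_1,\ldots,x_{r+1}\}$, $F\setminus C=\{z_1,\ldots,z_r\}$ (elements listed in the order of $S$), let $s$ be the number of transpositions needed to reorder the sequence $(F\cap C,F\setminus C)$ as $F$, and $$\alpha_C=(-1)^{(r+s)(t+1)} f_{D\cup\{x_r,\ldots,x_1\}}(x_{r+1})\prod_{i=1}^r\frac{f_{D\cup\{z_r,\ldots,z_i,x_{i-1},\ldots,x_1\}}(x_i)}{f_{D\cup\{z_r,\ldots,z_{i+1},x_i,\ldots,x_1\}}(z_i)}.$$ Then $\phi_S(Y_1,\ldots,Y_{k-1})=\sum_C \alpha_C\prod_{z\in E\setminus C}\frac{\det(z,Y_1,\ldots,Y_{k-1})}{\det(z,C)}$ if $q$ is even, and the same with $\alpha_C$ replaced by $\alpha_C^2$ if $q$ is odd, where the sum runs over all $(k-1)$-subsets $C$ of $E$ and $Y_1,\ldots,Y_{k-1}$ are vector variables in $\mathrm{V}_k(\mathbb{F}_q)$.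 *)

theory Defs
  imports
    "Jordan_Normal_Form.VS_Connect"
    "HOL-Library.Cardinality"
    "HOL-Library.Poly_Mapping"
    "HOL-Library.Sublist"
begin

(* V_k(F_q) is carrier_vec k over a finite field type; vectors are given by their coordinates
   with respect to the fixed basis used for determinants. *)

definition arc :: "nat \<Rightarrow> 'a::field vec set \<Rightarrow> bool" where
  "arc k S \<longleftrightarrow> S \<subseteq> carrier_vec k \<and>
     (\<forall>B\<subseteq>S. card B = k \<longrightarrow> vectorspace.basis class_ring (module_vec TYPE('a) k) B)"

(* A set with a fixed ordering of its elements is a list without repetitions. *)

definition ordering_of :: "'b set \<Rightarrow> 'b list \<Rightarrow> bool" where
  "ordering_of X xs \<longleftrightarrow> distinct xs \<and> set xs = X"

definition in_order :: "'b list \<Rightarrow> 'b set \<Rightarrow> 'b list" where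
  "in_order xs X = filter (\<lambda>x. x \<in> X) xs"

definition rows_det :: "nat \<Rightarrow> 'b::comm_ring_1 vec list \<Rightarrow> 'b" where
  "rows_det k vs = det (mat_of_rows k vs)"

definition M_rows :: "nat \<Rightarrow> 'b set \<Rightarrow> 'b set set" where
  "M_rows k G = {C. C \<subseteq> G \<and> card C = k - 1}"

definition M_cols :: "nat \<Rightarrow> 'b set \<Rightarrow> nat \<Rightarrow> ('b set \<times> 'b set) set" where
  "M_cols k G n =
     {(A, E'). E' \<subseteq> G \<and> card E' = card G - n \<and> A \<subseteq> E' \<and> card A = k - 2}"

definition M_entry ::
  "nat \<Rightarrow> 'a::field vec list \<Rightarrow> 'a vec set \<Rightarrow> 'a vec set \<times> 'a vec set \<Rightarrow> 'a" where
  "M_entry k gs C = (\<lambda>(A, E').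
     if A \<subset> C then \<Prod>u\<in>set gs - E'. rows_det k (u # in_order gs C) else 0)"

(* Column vectors are functions on the row index set, extended by 0 outside it. *)

definition M_column_space :: "nat \<Rightarrow> 'a::field vec list \<Rightarrow> nat \<Rightarrow> ('a vec set \<Rightarrow> 'a) set" where
  "M_column_space k gs n =
     {v. \<exists>c. \<forall>C. v C =
        (if C \<in> M_rows k (set gs)
         then \<Sum>j\<in>M_cols k (set gs) n. c j * M_entry k gs C j else 0)}"

(* CC is the set of the C_i; C and the C_i are pairwise distinct. *)

definition property_W :: "nat \<Rightarrow> 'a::field vec list \<Rightarrow> nat \<Rightarrow> bool" where
  "property_W k gs n \<longleftrightarrow>
     (\<forall>A. A \<subseteq> set gs \<and> card A = k - 2 \<longrightarrow>
       (\<exists>C CC. insert C CC \<subseteq> {C' \<in> M_rows k (set gs). A \<subseteq> C'} \<and>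
          C \<notin> CC \<and> card CC = card (set gs) - n - k + 1 \<and>
          (\<forall>Ci\<in>CC. \<exists>v\<in>M_column_space k gs n. {C'. v C' \<noteq> 0} = {C, Ci})))"

(* Linear forms are given by their coefficient vectors: a stands for the form x |-> a . x.
   forms A lists alpha_1, ..., alpha_t for the (k-2)-subset A. *)

definition tangent_forms ::
  "nat \<Rightarrow> nat \<Rightarrow> 'a::field vec set \<Rightarrow> ('a vec set \<Rightarrow> 'a vec list) \<Rightarrow> bool" where
  "tangent_forms k t S forms \<longleftrightarrow>
     (\<forall>A. A \<subseteq> S \<and> card A = k - 2 \<longrightarrow>
        length (forms A) = t \<and> distinct (forms A) \<and> set (forms A) \<subseteq> carrier_vec k \<and>
        (\<forall>a\<in>set (forms A). {x \<in> S. a \<bullet> x = 0} = A) \<and>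
        pairwise (\<lambda>a b. \<not> module.lin_dep class_ring (module_vec TYPE('a) k) {a, b})
          (set (forms A)))"

definition tangent_fun ::
  "('a::field vec set \<Rightarrow> 'a vec list) \<Rightarrow> 'a vec set \<Rightarrow> 'a vec \<Rightarrow> 'a" where
  "tangent_fun forms A x = (\<Prod>a\<leftarrow>forms A. a \<bullet> x)"

definition num_transpositions :: "'b list \<Rightarrow> 'b list \<Rightarrow> nat" where
  "num_transpositions xs ys =
     (LEAST m. \<exists>p. p permutes {..<length xs} \<and> swapidseq m p \<and> permute_list p xs = ys)"

(* Lists are indexed from 0: x_i is xs ! (i - 1), and {x_1, ..., x_i} is set (take i xs),
   {z_i, ..., z_r} is set (drop (i - 1) zs). *)

definition alpha_coeff ::
  "nat \<Rightarrow> nat \<Rightarrow> 'a::field vec list \<Rightarrow> ('a vec set \<Rightarrow> 'a vec list) \<Rightarrow> 'a vec set \<Rightarrow> 'a" where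
  "alpha_coeff k t ss forms C =
     (let Fs = take (k - 2) ss; F = set Fs;
          D = C \<inter> F;
          xs = in_order ss (C - F);
          zs = in_order ss (F - C);
          r = length zs;
          s = num_transpositions (in_order ss (F \<inter> C) @ in_order ss (F - C)) Fs;
          f = tangent_fun forms
      in (-1) ^ ((r + s) * (t + 1)) * f (D \<union> set (take r xs)) (xs ! r) *
         (\<Prod>i = 1..r.
            f (D \<union> set (drop (i - 1) zs) \<union> set (take (i - 1) xs)) (xs ! (i - 1)) /
            f (D \<union> set (drop i zs) \<union> set (take i xs)) (zs ! (i - 1))))"

(* Polynomials over 'a in the variables Y_(i,j), the j-th coordinate of the i-th vector
   variable (both counted from 0). *)

type_synonym 'a Ypoly = "((nat \<times> nat) \<Rightarrow>\<^sub>0 nat) \<Rightarrow>\<^sub>0 'a"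

definition Yconst :: "'a::comm_ring_1 \<Rightarrow> 'a Ypoly" where
  "Yconst c = Poly_Mapping.single 0 c"

definition Yvar :: "nat \<Rightarrow> nat \<Rightarrow> 'a::comm_ring_1 Ypoly" where
  "Yvar i j = Poly_Mapping.single (Poly_Mapping.single (i, j) 1) 1"

(* det(z, Y_1, ..., Y_(k-1)) *)
definition Ydet :: "nat \<Rightarrow> 'a::comm_ring_1 vec \<Rightarrow> 'a Ypoly" where
  "Ydet k z = rows_det k (map_vec Yconst z # map (\<lambda>i. vec k (Yvar i)) [0..<k - 1])"

definition phi ::
  "nat \<Rightarrow> 'a::{field, finite} vec set \<Rightarrow> 'a vec list \<Rightarrow> ('a vec set \<Rightarrow> 'a vec list) \<Rightarrow> 'a Ypoly"
where
  "phi k E ss forms =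
     (let q = CARD('a); t = q + k - 1 - length ss;
          coeff = (\<lambda>C. if even q then alpha_coeff k t ss forms C
                       else (alpha_coeff k t ss forms C)\<^sup>2)
      in \<Sum>C | C \<subseteq> E \<and> card C = k - 1.
           Yconst (coeff C) *
           (\<Prod>z\<in>E - C. Yconst (1 / rows_det k (z # in_order ss C)) * Ydet k z))"

end

(* By Segre's lemma of tangents, the ratios of the tangent functions of S on neighbouring
   (k-1)-subsets fit together, up to signs, to a potential on all (k-1)-subsets, of which alpha_C
   is a multiple up to sign. Interpolating f_A, a form of degree t in two variables modulo A, at
   t + 2 points shows that this potential, suitably weighted, lies in the left kernel of M_n.
   Property W then fixes its ratios on t + 2 of the sets containing A, interpolation extends this
   to all sets containing A, and connectivity of the Johnson graph leaves only a global scalar.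
   Only the square of alpha_C matters: in odd characteristic phi_S uses it, and in even
   characteristic it determines alpha_C. *)

theory Submission
  imports Defs "Jordan_Normal_Form.DL_Rank"
begin

section \<open>Determinants given by rows\<close>

text \<open>The constants fit together through t = |G| - k - n. A column (A, E') has |E' - A| = t +
  2, Property W supplies C and t + 1 further sets over A, and the prescribed size of S makes t the
  number of tangent hyperplanes at each (k-2)-subset. Hence one interpolation relation has t + 2
  terms, so t + 1 known values force the remaining one. The work happens on all of S, because
  Segre's lemma counts every hyperplane spanned by points of S together with the tangents; only the
  finished relation is restricted to G, where S and S' can be compared. Two obstacles shape the
  proof. First, a potential needs consistency around every cycle of exchanges. Triangles suffice:
  three sets over a common A agree by the very form of the ratios, and the sets D + xy, D + yz, D +
  zx are Segre's case. Secondly, Segre's lemma carries (-1)^(t+1), and the determinants in M_n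
  depend on the order inside C. A single sign, (-1)^(t+1) raised to the number of elements of A
  before x, repairs both, since every interpolation weight is a product of t + 1
  determinants.\<close>

lemma rows_det_linear_form:
  fixes us :: "'a::comm_ring_1 vec list"
  assumes "length us + 1 = k"
  shows "\<exists>a \<in> carrier_vec k. \<forall>v \<in> carrier_vec k. rows_det k (v # us) = a \<bullet> v"
proof
  let ?M = "\<lambda>v. mat_of_rows k (v # us)"
  \<comment> \<open>The cofactors along the first row do not involve that row, so the zero vector
    can stand in for \<open>v\<close>.\<close>
  let ?a = "vec k (\<lambda>j. cofactor (?M (0\<^sub>v k)) 0 j)"
  show "?a \<in> carrier_vec k" by simp
  show "\<forall>v \<in> carrier_vec k. rows_det k (v # us) = ?a \<bullet> v"
  proof
    fix v :: "'a vec" assume v: "v \<in> carrier_vec k"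
    have M: "?M w \<in> carrier_mat k k" for w :: "'a vec" using assms by auto
    have del: "mat_delete (?M v) 0 j = mat_delete (?M (0\<^sub>v k)) 0 j" for j
      unfolding mat_delete_def using assms by (auto simp: mat_of_rows_def)
    have "rows_det k (v # us) = (\<Sum>j<k. ?M v $$ (0, j) * cofactor (?M v) 0 j)"
      unfolding rows_det_def using assms by (intro laplace_expansion_row[OF M]) auto
    also have "\<dots> = (\<Sum>j<k. v $ j * cofactor (?M (0\<^sub>v k)) 0 j)"
      using assms by (intro sum.cong) (auto simp: cofactor_def del mat_of_rows_index)
    also have "\<dots> = ?a \<bullet> v"
      using v by (auto simp: scalar_prod_def lessThan_atLeast0 mult.commute intro!: sum.cong)
    finally show "rows_det k (v # us) = ?a \<bullet> v" .
  qed
qed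

lemma rows_det_swap:
  fixes x y :: "'a::comm_ring_1 vec"
  assumes "length ps + length qs + 2 = k"
  shows "rows_det k (ps @ x # y # qs) = - rows_det k (ps @ y # x # qs)"
proof -
  let ?M = "mat_of_rows k (ps @ y # x # qs)"
  have M: "?M \<in> carrier_mat k k" using assms by auto
  have "mat_of_rows k (ps @ x # y # qs) = swaprows (length ps) (Suc (length ps)) ?M"
    using assms by (intro eq_matI)
      (auto simp: mat_of_rows_index mat_of_rows_def mat_swaprows_def nth_append nth_Cons split: nat.splits)
  then show ?thesis
    unfolding rows_det_def using assms det_swaprows[OF _ _ _ M] by simp
qed

lemma rows_det_move_to_front:
  fixes x :: "'a::comm_ring_1 vec"
  assumes "length ps + length as + length bs + 1 = k"
  shows "rows_det k (ps @ as @ x # bs) = (-1) ^ length as * rows_det k (ps @ x # as @ bs)"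
  using assms
proof (induction as arbitrary: ps)
  case (Cons a as)
  have "rows_det k (ps @ (a # as) @ x # bs) = (-1) ^ length as * rows_det k (ps @ a # x # as @ bs)"
    using Cons.IH[of "ps @ [a]"] Cons.prems by simp
  also have "rows_det k (ps @ a # x # as @ bs) = - rows_det k (ps @ x # a # as @ bs)"
    using Cons.prems by (intro rows_det_swap) auto
  finally show ?case by simp
qed simp

lemma rows_det_not_distinct:
  assumes "length us = k" "\<not> distinct us"
  shows "rows_det k us = (0 :: 'a::comm_ring_1)"
proof -
  obtain i j where ij: "i < k" "j < k" "i \<noteq> j" "us ! i = us ! j"
    using assms by (auto simp: distinct_conv_nth)
  have "mat_of_rows k us \<in> carrier_mat k k" using assms by auto
  moreover have "row (mat_of_rows k us) i = row (mat_of_rows k us) j"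
    using ij assms by (auto simp: mat_of_rows_def row_def)
  ultimately show ?thesis
    unfolding rows_det_def using ij det_identical_rows by blast
qed

text \<open>The difference of the two forms lies in the kernel of an invertible matrix. Identities
  between linear forms can thus be checked on one basis.\<close>

lemma rows_det_form_eqI:
  fixes a b :: "'a::field vec"
  assumes "length us = k" "set us \<subseteq> carrier_vec k" "rows_det k us \<noteq> 0"
    and "a \<in> carrier_vec k" "b \<in> carrier_vec k"
    and eq: "\<And>u. u \<in> set us \<Longrightarrow> a \<bullet> u = b \<bullet> u"
  shows "a = b"
proof -
  let ?M = "mat_of_rows k us"
  have M: "?M \<in> carrier_mat k k" using assms by auto
  have "?M *\<^sub>v (a - b) = 0\<^sub>v k"
  proof (rule eq_vecI)
    fix i assume "i < dim_vec (0\<^sub>v k :: 'a vec)"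
    then have i: "i < length us" using assms by simp
    then have u: "us ! i \<in> set us" "us ! i \<in> carrier_vec k" using assms by auto
    have "(?M *\<^sub>v (a - b)) $ i = us ! i \<bullet> (a - b)" using i u assms by simp
    also have "\<dots> = us ! i \<bullet> a - us ! i \<bullet> b"
      using u assms by (intro scalar_prod_minus_distrib) auto
    also have "\<dots> = 0" using eq[OF u(1)] u assms by (simp add: comm_scalar_prod[of _ k])
    finally show "(?M *\<^sub>v (a - b)) $ i = 0\<^sub>v k $ i" using i assms by simp
  qed (use assms in auto)
  moreover have "det ?M \<noteq> 0" using assms by (simp add: rows_det_def)
  moreover have "a - b \<in> carrier_vec k" using assms by auto
  ultimately have z: "a - b = 0\<^sub>v k"
    using det_0_iff_vec_prod_zero_field[OF M] by metis
  show "a = b"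
  proof (rule eq_vecI)
    fix i assume "i < dim_vec b"
    then have "(a - b) $ i = 0" "i < k" using assms z by auto
    then show "a $ i = b $ i" using assms by auto
  qed (use assms in auto)
qed

lemma arc_rows_det_nonzero:
  fixes S :: "'a::field vec set"
  assumes "arc k S" "distinct us" "set us \<subseteq> S" "length us = k"
  shows "rows_det k us \<noteq> 0"
proof -
  interpret vec_space "TYPE('a)" k .
  have c: "set us \<subseteq> carrier_vec k" using assms by (auto simp: arc_def)
  have "card (set us) = k" using assms distinct_card by metis
  then have "basis (set us)" using assms by (auto simp: arc_def)
  then have ind: "\<not> lin_dep (set us)" by (auto simp: basis_def)
  \<comment> \<open>The rank criterion speaks of columns, so the vectors enter as columns and the
    determinant is transposed at the end.\<close>
  let ?M = "mat_of_cols k us"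
  have M: "?M \<in> carrier_mat k k" using assms by auto
  have cols: "cols ?M = us" using c by simp
  have "rank ?M = k" using lin_indpt_full_rank[OF M] cols ind assms by simp
  then have "det ?M \<noteq> 0" using det_rank_iff[OF M] by simp
  moreover have "det ?M = det (mat_of_rows k us)"
    using det_transpose[OF M] by (simp add: transpose_mat_of_cols)
  ultimately show ?thesis by (simp add: rows_det_def)
qed

text \<open>Cramer's rule in the two-dimensional quotient by the span of \<open>as\<close>. Both
  sides are linear in \<open>x\<close>, vanish on \<open>as\<close>, and agree at \<open>a\<close>
  and at \<open>b\<close>.\<close>

lemma rows_det_three_term:
  fixes l :: "'a::field vec"
  assumes "length as + 2 = k" "set as \<subseteq> carrier_vec k"
    and "a \<in> carrier_vec k" "b \<in> carrier_vec k" "x \<in> carrier_vec k" "l \<in> carrier_vec k"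
    and l: "\<And>u. u \<in> set as \<Longrightarrow> l \<bullet> u = 0"
    and ne: "rows_det k (a # b # as) \<noteq> 0"
  shows "(l \<bullet> x) * rows_det k (a # b # as) =
    (l \<bullet> a) * rows_det k (x # b # as) - (l \<bullet> b) * rows_det k (x # a # as)"
proof -
  obtain f where f: "f \<in> carrier_vec k"
    "\<And>v. v \<in> carrier_vec k \<Longrightarrow> rows_det k (v # b # as) = f \<bullet> v"
    using rows_det_linear_form[of "b # as" k] assms(1) by auto
  obtain g where g: "g \<in> carrier_vec k"
    "\<And>v. v \<in> carrier_vec k \<Longrightarrow> rows_det k (v # a # as) = g \<bullet> v"
    using rows_det_linear_form[of "a # as" k] assms(1) by auto
  define d where "d = rows_det k (a # b # as)"
  have d': "rows_det k (b # a # as) = - d"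
    using rows_det_swap[of "[]" as k b a] assms(1) by (simp add: d_def)
  let ?h = "(l \<bullet> a) \<cdot>\<^sub>v f - (l \<bullet> b) \<cdot>\<^sub>v g"
  have h: "?h \<bullet> v = (l \<bullet> a) * rows_det k (v # b # as) - (l \<bullet> b) * rows_det k (v # a # as)"
    if "v \<in> carrier_vec k" for v
    using that f g assms by (simp add: minus_scalar_prod_distrib[of _ k])
  have "d \<cdot>\<^sub>v l = ?h"
  proof (rule rows_det_form_eqI[where us = "a # b # as" and k = k])
    fix u assume u: "u \<in> set (a # b # as)"
    then have uc: "u \<in> carrier_vec k" using assms by auto
    have z: "rows_det k (v # w # as) = 0" if "\<not> distinct (v # w # as)" for v w :: "'a vec"
      using assms that by (intro rows_det_not_distinct) auto
    show "(d \<cdot>\<^sub>v l) \<bullet> u = ?h \<bullet> u"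
      unfolding h[OF uc] using u assms(6) uc d' l z by (auto simp flip: d_def)
  qed (use assms f g in \<open>auto simp: d_def\<close>)
  then have "(d \<cdot>\<^sub>v l) \<bullet> x = ?h \<bullet> x" by simp
  then show ?thesis using h[of x] assms by (simp add: d_def mult.commute)
qed

lemma lin_dep_smult_pair:
  fixes a b :: "'a::field vec"
  assumes "a \<in> carrier_vec k" "b \<in> carrier_vec k" "a = c \<cdot>\<^sub>v b" "a \<noteq> b"
  shows "module.lin_dep class_ring (module_vec TYPE('a) k) {a, b}"
proof -
  interpret vec_space "TYPE('a)" k .
  define A where "A = mat_of_cols k [a, b]"
  \<comment> \<open>The relation \<open>a - c b = 0\<close> as a kernel vector of the two-column
    matrix; \<open>a \<noteq> b\<close> keeps its columns distinct.\<close>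
  define v where "v = vec 2 (\<lambda>i. if i = 0 then 1 else - c)"
  have cols: "cols A = [a, b]" unfolding A_def using assms(1,2) by simp
  have A: "A \<in> carrier_mat k 2" using mat_of_cols_carrier(1)[of k "[a, b]"] by (simp add: A_def numeral_2_eq_2)
  have v: "v \<in> carrier_vec 2" by (simp add: v_def)
  have "v $ 0 \<noteq> (0\<^sub>v 2 :: 'a vec) $ 0" by (simp add: v_def)
  then have v0: "v \<noteq> 0\<^sub>v 2" by auto
  have Av: "A *\<^sub>v v = 0\<^sub>v k"
  proof (rule eq_vecI)
    fix i assume "i < dim_vec (0\<^sub>v k :: 'a vec)"
    then have i: "i < k" by simp
    then have "(A *\<^sub>v v) $ i = a $ i - c * b $ i"
      by (simp add: A_def v_def scalar_prod_def mat_of_cols_def row_def numeral_2_eq_2)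
    also have "\<dots> = 0" using i assms(2) by (subst assms(3)) simp
    finally show "(A *\<^sub>v v) $ i = 0\<^sub>v k $ i" using i by simp
  qed (simp add: A_def)
  show ?thesis
    using lin_depI[OF A v v0 Av] assms(4) unfolding cols by simp
qed

section \<open>Potentials and interpolation\<close>

lemma prod_inverse_closed:
  fixes X :: "'a::field set"
  assumes "finite X" "\<And>x. x \<in> X \<Longrightarrow> inverse x \<in> X \<and> inverse x \<noteq> x \<and> x \<noteq> 0"
  shows "\<Prod>X = 1"
  using assms
proof (induction X rule: finite_psubset_induct)
  case (psubset X)
  show ?case
  proof (cases "X = {}")
    case False
    then obtain x where x: "x \<in> X" by auto
    then have i: "inverse x \<in> X" "inverse x \<noteq> x" "x \<noteq> 0" using psubset.prems by auto
    \<comment> \<open>A pair of mutually inverse elements contributes 1, and the rest is still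
      closed under inverses.\<close>
    let ?Y = "X - {x} - {inverse x}"
    have "\<Prod>?Y = 1"
    proof (rule psubset.IH)
      show "?Y \<subset> X" using x by auto
      fix y assume y: "y \<in> ?Y"
      then show "inverse y \<in> ?Y \<and> inverse y \<noteq> y \<and> y \<noteq> 0"
        using psubset.prems[of y] by auto
    qed
    then show ?thesis
      using x i psubset.hyps prod.remove[of X x id] prod.remove[of "X - {x}" "inverse x" id]
      by simp
  qed simp
qed

text \<open>Wilson's theorem: every element other than \<open>1\<close> and \<open>-1\<close> cancels against its inverse.\<close>
lemma prod_nonzero_finite_field: "\<Prod>(UNIV - {0 :: 'a::{field, finite}}) = -1"
proof -
  have "\<Prod>(UNIV - {0, 1, -1 :: 'a}) = 1"
  proof (rule prod_inverse_closed)
    fix x :: 'a assume x: "x \<in> UNIV - {0, 1, -1}"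
    have "inverse x \<noteq> x"
    proof
      assume "inverse x = x"
      then have "x * x = 1" using x by (metis DiffD2 insertCI right_inverse)
      then have "(x - 1) * (x + 1) = 0" by (simp add: algebra_simps)
      then show False using x by (auto simp: add_eq_0_iff2)
    qed
    moreover have "inverse x \<noteq> -1"
      using x by (metis DiffD2 insertCI inverse_inverse_eq inverse_minus_eq inverse_1)
    ultimately show "inverse x \<in> UNIV - {0, 1, -1} \<and> inverse x \<noteq> x \<and> x \<noteq> 0"
      using x by auto
  qed simp
  moreover have "UNIV - {0} = insert 1 (insert (-1) (UNIV - {0, 1, -1 :: 'a}))" by auto
  ultimately show ?thesis
    \<comment> \<open>In characteristic two \<open>1\<close> and \<open>-1\<close> coincide: only
      one element is put back, and the product 1 is again -1.\<close>
    by (cases "(1 :: 'a) = -1") (simp_all add: insert_absorb)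
qed

text \<open>Trading an element of \<open>C - C'\<close> for one of \<open>C' - C\<close> is one use
  of \<open>step\<close> and lowers \<open>card (C - C')\<close> by one.\<close>

lemma johnson_connected:
  assumes "finite X"
    and step: "\<And>A x y. A \<subseteq> X \<Longrightarrow> card A = m \<Longrightarrow> x \<in> X - A \<Longrightarrow> y \<in> X - A \<Longrightarrow>
      h (insert x A) = h (insert y A)"
    and "C \<subseteq> X" "card C = Suc m" "C' \<subseteq> X" "card C' = Suc m"
  shows "h C = h C'"
  using assms(3,4)
proof (induction "card (C - C')" arbitrary: C)
  case 0
  have "finite C" "finite C'" using 0 assms finite_subset by auto
  then have "C \<subseteq> C'" using 0 by auto
  then have "C = C'" using \<open>finite C'\<close> 0 assms card_subset_eq by metis
  then show ?case by simp
next
  case (Suc n)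
  have fin: "finite C" "finite C'" using Suc assms finite_subset by auto
  obtain x where x: "x \<in> C" "x \<notin> C'"
    using Suc.hyps(2) by (metis Diff_iff card.empty ex_in_conv nat.distinct(1))
  have "\<not> C' \<subseteq> C" using fin x Suc.prems assms(6) card_subset_eq by metis
  then obtain y where y: "y \<in> C'" "y \<notin> C" by auto
  let ?A = "C - {x}"
  have cA: "card ?A = m" using x Suc.prems by simp
  have "h (insert x ?A) = h (insert y ?A)"
    using x y Suc.prems assms(5) cA by (intro step) auto
  moreover have "insert x ?A = C" using x by auto
  moreover have "h (insert y ?A) = h C'"
  proof (rule Suc.hyps(1))
    have "insert y ?A - C' = (C - C') - {x}" using y by auto
    then show "n = card (insert y ?A - C')" using x Suc.hyps(2) by simp
    show "insert y ?A \<subseteq> X" using y Suc.prems assms(5) by auto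
    show "card (insert y ?A) = Suc m" using fin y cA by simp
  qed
  ultimately show ?case by simp
qed

text \<open>Lagrange interpolation for a product of t linear forms in two homogeneous variables, at
  t + 2 points. The abstract bracket replaces coordinates on the quotient modulo A. For the
  induction, multiply by \<open>br a b\<close> and split the first form with \<open>three\<close>;
  the factor \<open>br x b\<close> then cancels against one factor of the weight up to sign, which
  leaves the same sum over \<open>P - {b}\<close>.\<close>

lemma bracket_interpolation:
  fixes br :: "'v \<Rightarrow> 'v \<Rightarrow> 'a::field" and ls :: "('v \<Rightarrow> 'a) list"
  assumes "card P = length ls + 2"
    and anti: "\<And>x y. x \<in> P \<Longrightarrow> y \<in> P \<Longrightarrow> br y x = - br x y"
    and diag: "\<And>x. x \<in> P \<Longrightarrow> br x x = 0"
    and nz: "\<And>x y. x \<in> P \<Longrightarrow> y \<in> P \<Longrightarrow> x \<noteq> y \<Longrightarrow> br x y \<noteq> 0"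
    and three: "\<And>l a b x. l \<in> set ls \<Longrightarrow> a \<in> P \<Longrightarrow> b \<in> P \<Longrightarrow> x \<in> P \<Longrightarrow> a \<noteq> b \<Longrightarrow>
      l x * br a b = l a * br x b - l b * br x a"
  shows "(\<Sum>x\<in>P. (\<Prod>l\<leftarrow>ls. l x) * (\<Prod>y\<in>P - {x}. inverse (br y x))) = 0"
  using assms
proof (induction ls arbitrary: P)
  case Nil
  have "card P = 2" using Nil.prems(1) by simp
  then obtain a b where P: "P = {a, b}" "a \<noteq> b" unfolding card_2_iff by auto
  have "P - {a} = {b}" "P - {b} = {a}" using P by auto
  moreover have "br b a = - br a b" using Nil.prems(2)[of a b] P by simp
  ultimately show ?case using P by simp
next
  case (Cons l ls)
  have fin: "finite P" using Cons.prems(1) by (intro card_ge_0_finite) simp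
  define T where "T = (\<lambda>Q x. (\<Prod>l\<leftarrow>ls. l x) * (\<Prod>y\<in>Q - {x}. inverse (br y x)))"
  have zero: "(\<Sum>x\<in>P. br x b * T P x) = 0" if b: "b \<in> P" for b
  proof -
    have t: "br x b * T P x = - T (P - {b}) x" if x: "x \<in> P - {b}" for x
    proof -
      have "(\<Prod>y\<in>P - {x}. inverse (br y x)) =
          inverse (br b x) * (\<Prod>y\<in>P - {x} - {b}. inverse (br y x))"
        using x b fin by (intro prod.remove) auto
      moreover have "P - {x} - {b} = P - {b} - {x}" by auto
      ultimately have "br x b * T P x = br x b * inverse (br b x) * T (P - {b}) x"
        by (simp add: T_def)
      also have "br x b * inverse (br b x) = -1"
        using Cons.prems(2)[of x b] Cons.prems(4)[of x b] x b by simp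
      finally show ?thesis by simp
    qed
    have "(\<Sum>x\<in>P. br x b * T P x) = br b b * T P b + (\<Sum>x\<in>P - {b}. br x b * T P x)"
      using b fin by (simp add: sum.remove)
    also have "\<dots> = (\<Sum>x\<in>P - {b}. - T (P - {b}) x)"
      using Cons.prems(3) b t by simp
    also have "\<dots> = - (\<Sum>x\<in>P - {b}. T (P - {b}) x)" by (simp add: sum_negf)
    also have "(\<Sum>x\<in>P - {b}. T (P - {b}) x) = 0"
      unfolding T_def
    proof (rule Cons.IH)
      show "card (P - {b}) = length ls + 2" using Cons.prems(1) b by simp
      fix x y assume xy: "x \<in> P - {b}" "y \<in> P - {b}"
      show "br y x = - br x y" using Cons.prems(2) xy by blast
      show "br x y \<noteq> 0" if "x \<noteq> y" using Cons.prems(4) xy that by blast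
    next
      fix l' a c x assume "l' \<in> set ls" "a \<in> P - {b}" "c \<in> P - {b}" "x \<in> P - {b}" "a \<noteq> c"
      then show "l' x * br a c = l' a * br x c - l' c * br x a"
        by (intro Cons.prems(5)) auto
    qed (use Cons.prems(3) in auto)
    finally show ?thesis by simp
  qed
  obtain a where a: "a \<in> P" using Cons.prems(1) by fastforce
  have "card (P - {a}) > 0" using Cons.prems(1) a by simp
  then obtain b where b: "b \<in> P" "a \<noteq> b" by (auto simp: card_gt_0_iff)
  have ab: "br a b \<noteq> 0" using Cons.prems(4) a b by auto
  have "br a b * (\<Sum>x\<in>P. (\<Prod>l\<leftarrow>l # ls. l x) * (\<Prod>y\<in>P - {x}. inverse (br y x)))
      = (\<Sum>x\<in>P. l a * (br x b * T P x) - l b * (br x a * T P x))"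
    unfolding sum_distrib_left
  proof (rule sum.cong)
    fix x assume x: "x \<in> P"
    have "br a b * ((\<Prod>l\<leftarrow>l # ls. l x) * (\<Prod>y\<in>P - {x}. inverse (br y x))) = (l x * br a b) * T P x"
      by (simp add: T_def)
    also have "l x * br a b = l a * br x b - l b * br x a"
      using Cons.prems(5)[of l a b x] a b x by simp
    finally show "br a b * ((\<Prod>l\<leftarrow>l # ls. l x) * (\<Prod>y\<in>P - {x}. inverse (br y x)))
      = l a * (br x b * T P x) - l b * (br x a * T P x)" by (simp add: algebra_simps)
  qed simp
  also have "\<dots> = l a * (\<Sum>x\<in>P. br x b * T P x) - l b * (\<Sum>x\<in>P. br x a * T P x)"
    by (simp add: sum_subtractf sum_distrib_left)
  also have "\<dots> = 0" using zero a b by simp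
  finally show ?case using ab by simp
qed

text \<open>A multiplicative potential on the Johnson graph of (m+1)-subsets: where \<open>g\<close>
  is nonzero, the edge joining \<open>insert y A\<close> to \<open>insert x A\<close> carries the
  ratio \<open>g A x / g A y\<close>. The condition is cross-multiplied to avoid division.\<close>

definition exchange_potential :: "'b set \<Rightarrow> nat \<Rightarrow> ('b set \<Rightarrow> 'b \<Rightarrow> 'a::field) \<Rightarrow> ('b set \<Rightarrow> 'a) \<Rightarrow> bool" where
  "exchange_potential X m g p \<longleftrightarrow> (\<forall>C\<subseteq>X. card C = Suc m \<longrightarrow> p C \<noteq> 0) \<and>
    (\<forall>A x y. A \<subseteq> X \<and> card A = m \<and> x \<in> X - A \<and> y \<in> X - A \<longrightarrow>
      p (insert x A) * g A y = p (insert y A) * g A x)"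

lemma exchange_potentialD:
  assumes "exchange_potential X m g p"
  shows "\<And>C. C \<subseteq> X \<Longrightarrow> card C = Suc m \<Longrightarrow> p C \<noteq> 0"
    and "\<And>A x y. A \<subseteq> X \<Longrightarrow> card A = m \<Longrightarrow> x \<in> X - A \<Longrightarrow> y \<in> X - A \<Longrightarrow>
      p (insert x A) * g A y = p (insert y A) * g A x"
  using assms unfolding exchange_potential_def by blast+

text \<open>Induction on \<open>X\<close>, adding a point \<open>v\<close>. The sets avoiding
  \<open>v\<close> carry a potential \<open>p0\<close>; those containing \<open>v\<close> carry a
  potential \<open>p1\<close>, indexed by the set without \<open>v\<close> and hence of size one
  less. Only the edges between the two families remain, and one scalar must make all of them
  consistent.\<close>

lemma exchange_potential_exists:
  fixes g :: "'b set \<Rightarrow> 'b \<Rightarrow> 'a::field"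
  assumes "finite X"
    and "\<And>A x. A \<subseteq> X \<Longrightarrow> card A = m \<Longrightarrow> x \<in> X - A \<Longrightarrow> g A x \<noteq> 0"
    and "\<And>D x y z. D \<subseteq> X \<Longrightarrow> Suc (card D) = m \<Longrightarrow> x \<in> X - D \<Longrightarrow> y \<in> X - D \<Longrightarrow> z \<in> X - D \<Longrightarrow>
      x \<noteq> y \<Longrightarrow> y \<noteq> z \<Longrightarrow> x \<noteq> z \<Longrightarrow>
      g (insert x D) y * g (insert y D) z * g (insert z D) x =
      g (insert y D) x * g (insert z D) y * g (insert x D) z"
  shows "\<exists>p. exchange_potential X m g p"
  using assms
proof (induction X arbitrary: m g rule: finite_induct)
  case empty
  show ?case unfolding exchange_potential_def by (intro exI[of _ "\<lambda>_. 1"]) auto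
next
  case (insert v X)
  note nz = insert.prems(1) and tri = insert.prems(2)
  show ?case
  proof (cases m)
    case 0
    have empty: "A = {}" if "A \<subseteq> insert v X" "card A = 0" for A
      using that insert.hyps(1) finite_subset by fastforce
    show ?thesis
      unfolding exchange_potential_def
    proof (intro exI[of _ "\<lambda>C. g {} (the_elem C)"] conjI allI impI)
      fix C assume "C \<subseteq> insert v X" "card C = Suc m"
      moreover then obtain a where "C = {a}" using 0 by (auto simp: card_Suc_eq)
      ultimately show "g {} (the_elem C) \<noteq> 0" using nz[of "{}" a] 0 by auto
    next
      fix A x y assume "A \<subseteq> insert v X \<and> card A = m \<and> x \<in> insert v X - A \<and> y \<in> insert v X - A"
      then have "A = {}" using empty 0 by auto
      then show "g {} (the_elem (insert x A)) * g A y = g {} (the_elem (insert y A)) * g A x"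
        by simp
    qed
  next
    case (Suc m')
    have finA: "finite A" "v \<notin> A" if "A \<subseteq> X" for A
      using that insert.hyps finite_subset by auto
    have "\<exists>p. exchange_potential X m g p"
      by (rule insert.IH; (rule nz | rule tri); auto)
    then obtain p0 where "exchange_potential X m g p0" by auto
    note p0 = exchange_potentialD[OF this]
    have "\<exists>p. exchange_potential X m' (\<lambda>A. g (insert v A)) p"
    proof (rule insert.IH)
      fix A x assume "A \<subseteq> X" "card A = m'" "x \<in> X - A"
      then show "g (insert v A) x \<noteq> 0"
        using nz[of "insert v A" x] Suc insert.hyps finA[of A] by (auto simp: card_insert_if)
    next
      fix D x y z assume "D \<subseteq> X" "Suc (card D) = m'" "x \<in> X - D" "y \<in> X - D" "z \<in> X - D"
        "x \<noteq> y" "y \<noteq> z" "x \<noteq> z"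
      then show "g (insert v (insert x D)) y * g (insert v (insert y D)) z * g (insert v (insert z D)) x =
        g (insert v (insert y D)) x * g (insert v (insert z D)) y * g (insert v (insert x D)) z"
        using tri[of "insert v D" x y z] Suc insert.hyps finA[of D]
        by (auto simp: card_insert_if insert_commute)
    qed
    then obtain p1 where "exchange_potential X m' (\<lambda>A. g (insert v A)) p1" by auto
    note p1 = exchange_potentialD[OF this, folded Suc]
    \<comment> \<open>The scalar by which \<open>p0\<close> must be multiplied for the edge from
      \<open>insert v A\<close> to \<open>insert x A\<close> to be consistent. It has to be the same
      for all edges.\<close>
    define \<rho> where "\<rho> = (\<lambda>A x. p1 A * g A x / (p0 (insert x A) * g A v))"
    have nzs: "g A x \<noteq> 0" "g A v \<noteq> 0" "p1 A \<noteq> 0" "p0 (insert x A) \<noteq> 0"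
      if "A \<subseteq> X" "card A = m" "x \<in> X - A" for A x
      using that nz[of A x] nz[of A v] p1(1)[of A] p0(1)[of "insert x A"] insert.hyps finA[of A]
      by (auto simp: card_insert_if)
    have \<rho>1: "\<rho> A x = \<rho> A y" if "A \<subseteq> X" "card A = m" "x \<in> X - A" "y \<in> X - A" for A x y
      using nzs[OF that(1,2,3)] nzs[OF that(1,2,4)] p0(2)[OF that]
      by (simp add: \<rho>_def field_simps)
    \<comment> \<open>Two crossing edges that end in the same set without \<open>v\<close>. Writing
      that set as D + x + x', the claim is the triangle hypothesis for x, x', v over D, combined
      with the exchange rule of \<open>p1\<close> at D.\<close>
    have \<rho>2: "\<rho> A x = \<rho> A' x'"
      if A: "A \<subseteq> X" "card A = m" "x \<in> X - A" "A' \<subseteq> X" "card A' = m" "x' \<in> X - A'"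
        and eq: "insert x A = insert x' A'" for A A' x x'
    proof (cases "x = x'")
      case True
      then show ?thesis using that by (metis Diff_iff Diff_insert_absorb)
    next
      case False
      define D where "D = A - {x'}"
      have D: "A = insert x' D" "A' = insert x D" "x \<notin> D" "x' \<notin> D"
        using that False by (auto simp: D_def)
      have Dm: "D \<subseteq> X" "card D = m'" using D A Suc finA[of A] by (auto simp: D_def)
      have v: "v \<notin> D" "v \<noteq> x" "v \<noteq> x'" using A insert.hyps Dm by auto
      have t: "g (insert x D) x' * g (insert x' D) v * g (insert v D) x =
          g (insert x' D) x * g (insert v D) x' * g (insert x D) v"
        using D Dm A Suc v False by (intro tri) auto
      have p: "p1 (insert x D) * g (insert v D) x' = p1 (insert x' D) * g (insert v D) x"
        using p1(2)[of D x x'] D Dm A by auto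
      have nv: "g (insert v D) x \<noteq> 0" "g (insert v D) x' \<noteq> 0"
        using nz[of "insert v D" x] nz[of "insert v D" x'] v D Dm A Suc finA[of D]
        by (auto simp: card_insert_if)
      have nA: "g A x \<noteq> 0" "g A v \<noteq> 0" "p0 (insert x A) \<noteq> 0"
          "g A' x' \<noteq> 0" "g A' v \<noteq> 0"
        using nzs[OF A(1-3)] nzs[OF A(4-6)] by auto
      have "g (insert v D) x * (p1 A * g A x * g A' v) = g (insert v D) x * (p1 A' * g A' x' * g A v)"
      proof -
        have "g (insert v D) x * (p1 A * g A x * g A' v)
            = (p1 A * g (insert v D) x) * g A x * g A' v" by simp
        also have "p1 A * g (insert v D) x = p1 A' * g (insert v D) x'" using p D by simp
        also have "p1 A' * g (insert v D) x' * g A x * g A' v =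
            p1 A' * (g A x * g (insert v D) x' * g A' v)" by simp
        also have "g A x * g (insert v D) x' * g A' v = g A' x' * g A v * g (insert v D) x"
          using t D by simp
        finally show ?thesis by (simp add: ac_simps)
      qed
      then have "p1 A * g A x * g A' v = p1 A' * g A' x' * g A v" using nv by simp
      then show ?thesis
        unfolding \<rho>_def using nA eq by (simp add: divide_eq_eq eq_divide_eq ac_simps)
    qed
    \<comment> \<open>Connectivity needs a function of the set \<open>insert x A\<close> alone. An
      arbitrary element of it serves as \<open>x\<close>; \<open>\<rho>2\<close> makes the choice
      irrelevant.\<close>
    define z where "z = (\<lambda>C :: 'b set. SOME z. z \<in> C)"
    define h where "h = (\<lambda>C. \<rho> (C - {z C}) (z C))"
    have h: "h (insert x A) = \<rho> A x" if A: "A \<subseteq> X" "card A = m" "x \<in> X - A" for A x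
    proof -
      have zC: "z (insert x A) \<in> insert x A" unfolding z_def by (rule someI) (rule insertI1)
      show ?thesis unfolding h_def
        using A zC finA[of A] by (intro \<rho>2) (auto simp: card_Diff_singleton card_insert_if)
    qed
    have "\<exists>c. c \<noteq> 0 \<and> (\<forall>A x. A \<subseteq> X \<and> card A = m \<and> x \<in> X - A \<longrightarrow> \<rho> A x = c)"
    proof (cases "\<exists>B b. B \<subseteq> X \<and> card B = m \<and> b \<in> X - B")
      case True
      then obtain B b where B: "B \<subseteq> X" "card B = m" "b \<in> X - B" by auto
      show ?thesis
      proof (intro exI[of _ "\<rho> B b"] conjI allI impI)
        show "\<rho> B b \<noteq> 0" using nzs[OF B] by (simp add: \<rho>_def)
        fix A x assume A: "A \<subseteq> X \<and> card A = m \<and> x \<in> X - A"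
        have "h (insert x A) = h (insert b B)"
        proof (rule johnson_connected[OF insert.hyps(1), where m = m])
          fix A x y assume a: "A \<subseteq> X" "card A = m" "x \<in> X - A" "y \<in> X - A"
          show "h (insert x A) = h (insert y A)"
            using h[OF a(1-3)] h[OF a(1,2,4)] \<rho>1[OF a] by simp
        qed (use A B finA[of A] finA[of B] in auto)
        then show "\<rho> A x = \<rho> B b" using h[of A x] h[OF B] A by simp
      qed
    next
      case False
      then show ?thesis by (intro exI[of _ 1]) auto
    qed
    then obtain c where c: "c \<noteq> 0"
      "\<And>A x. A \<subseteq> X \<Longrightarrow> card A = m \<Longrightarrow> x \<in> X - A \<Longrightarrow> \<rho> A x = c" by auto
    have link: "p1 A * g A x = c * p0 (insert x A) * g A v"
      if "A \<subseteq> X" "card A = m" "x \<in> X - A" for A x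
      using c(2)[OF that] nzs[OF that] by (simp add: \<rho>_def field_simps)
    \<comment> \<open>The two potentials glued with the scalar from the crossing edges.\<close>
    define p where "p = (\<lambda>C. if v \<in> C then p1 (C - {v}) else c * p0 C)"
    show ?thesis
      unfolding exchange_potential_def
    proof (intro exI[of _ p] conjI allI impI)
      fix C assume C: "C \<subseteq> insert v X" "card C = Suc m"
      then have "C - {v} \<subseteq> X" "v \<notin> C \<Longrightarrow> C \<subseteq> X" by auto
      then show "p C \<noteq> 0"
        using C c(1) p0(1)[of C] p1(1)[of "C - {v}"] by (auto simp: p_def)
    next
      fix A x y assume A: "A \<subseteq> insert v X \<and> card A = m \<and> x \<in> insert v X - A \<and> y \<in> insert v X - A"
      show "p (insert x A) * g A y = p (insert y A) * g A x"
      proof (cases "v \<in> A")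
        case True
        define B where "B = A - {v}"
        have B: "A = insert v B" "v \<notin> B" "B \<subseteq> X" using True A by (auto simp: B_def)
        have xy: "x \<in> X - B" "y \<in> X - B" "x \<noteq> v" "y \<noteq> v" using A B by auto
        have "card B = m'" using A B Suc finA[of B] by auto
        moreover have "insert x A - {v} = insert x B" "insert y A - {v} = insert y B"
          using B xy by auto
        ultimately show ?thesis using p1(2)[of B x y] B xy by (simp add: p_def)
      next
        case False
        then have AX: "A \<subseteq> X" "card A = m" using A by auto
        have "insert v A - {v} = A" using False by auto
        then show ?thesis
          using A False link[OF AX, of x] link[OF AX, of y] p0(2)[OF AX, of x y]
          by (cases "x = v"; cases "y = v") (auto simp: p_def)
      qed
    qed
  qed
qed

section \<open>The left kernel of the matrix\<close>

text \<open>Orthogonality to the columns of M_n, with the factors outside E' already cancelled. In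
  this form it refers to an ordered point set and to t only, so it can be proved for S and then
  restricted to G.\<close>

definition tangent_relation :: "nat \<Rightarrow> nat \<Rightarrow> 'a::field vec list \<Rightarrow> ('a vec set \<Rightarrow> 'a) \<Rightarrow> bool" where
  "tangent_relation k t gs p \<longleftrightarrow>
    (\<forall>A E'. E' \<subseteq> set gs \<and> card E' = k + t \<and> A \<subseteq> E' \<and> card A = k - 2 \<longrightarrow>
      (\<Sum>x\<in>E' - A. p (insert x A) *
        (\<Prod>u\<in>E' - insert x A. inverse (rows_det k (u # in_order gs (insert x A))))) = 0)"

lemma tangent_relationD:
  assumes "tangent_relation k t gs p" "E' \<subseteq> set gs" "card E' = k + t" "A \<subseteq> E'" "card A = k - 2"
  shows "(\<Sum>x\<in>E' - A. p (insert x A) *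
    (\<Prod>u\<in>E' - insert x A. inverse (rows_det k (u # in_order gs (insert x A))))) = 0"
  using assms unfolding tangent_relation_def by blast

section \<open>Ordered subsets and the pairing of weighted solutions with the columns of M_n\<close>

lemma set_in_order [simp]: "set (in_order xs X) = set xs \<inter> X"
  by (auto simp: in_order_def)

lemma distinct_in_order [simp]: "distinct xs \<Longrightarrow> distinct (in_order xs X)"
  by (simp add: in_order_def)

lemma length_in_order: "distinct xs \<Longrightarrow> X \<subseteq> set xs \<Longrightarrow> length (in_order xs X) = card X"
  by (metis distinct_card distinct_in_order inf.absorb2 set_in_order)

lemma rows_det_in_order_eq_0_iff:
  fixes gs :: "'a::field vec list"
  assumes "arc k (set gs)" "distinct gs" "C \<subseteq> set gs" "Suc (card C) = k" "u \<in> set gs"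
  shows "rows_det k (u # in_order gs C) = 0 \<longleftrightarrow> u \<in> C"
proof
  have len: "length (u # in_order gs C) = k" using assms length_in_order[of gs C] by simp
  show "u \<in> C" if "rows_det k (u # in_order gs C) = 0"
  proof (rule ccontr)
    assume "u \<notin> C"
    then have "rows_det k (u # in_order gs C) \<noteq> 0"
      using assms len by (intro arc_rows_det_nonzero[of k "set gs"]) auto
    then show False using that by simp
  qed
  show "rows_det k (u # in_order gs C) = 0" if "u \<in> C"
    using that len assms by (intro rows_det_not_distinct) auto
qed

text \<open>The weight of \<open>C\<close> clears the factors outside \<open>E'\<close> in every column \<open>(A, E')\<close> of the matrix.\<close>
definition row_weight :: "nat \<Rightarrow> 'a::field vec list \<Rightarrow> 'a vec set \<Rightarrow> 'a" where
  "row_weight k gs C = (\<Prod>u\<in>set gs - C. inverse (rows_det k (u # in_order gs C)))"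

lemma M_left_kernel:
  fixes gs :: "'a::field vec list"
  assumes "arc k (set gs)" "distinct gs" "2 \<le> k" "k + t + n = card (set gs)"
    and rel: "tangent_relation k t gs p"
    and col: "(A, E') \<in> M_cols k (set gs) n"
  shows "(\<Sum>C\<in>M_rows k (set gs). p C * row_weight k gs C * M_entry k gs C (A, E')) = 0"
proof -
  let ?G = "set gs"
  let ?d = "\<lambda>C u. rows_det k (u # in_order gs C)"
  have E': "E' \<subseteq> ?G" "card E' = k + t" "A \<subseteq> E'" "card A = k - 2"
    using col assms(4) by (auto simp: M_cols_def)
  have finE: "finite E'" "finite A" using E'(1,3) by (meson List.finite_set finite_subset)+
  let ?I = "(\<lambda>x. insert x A) ` (E' - A)"
  have I: "?I \<subseteq> M_rows k ?G"
    using E' finE assms(3) by (auto simp: M_rows_def)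
  \<comment> \<open>If C contains A but is not of the form A + x inside E', some \<open>u\<close> in
    C lies outside E', and the determinant with \<open>u\<close> repeated kills the entry.\<close>
  have zero: "M_entry k gs C (A, E') = 0" if C: "C \<in> M_rows k ?G - ?I" for C
  proof (cases "A \<subset> C")
    case True
    have C': "C \<subseteq> ?G" "card C = k - 1" using C by (auto simp: M_rows_def)
    have "\<not> C \<subseteq> E'"
    proof
      assume CE: "C \<subseteq> E'"
      have "finite C" using CE finE finite_subset by auto
      have "card (C - A) = 1"
        using True C' E' assms(3) finE by (simp add: card_Diff_subset psubset_imp_subset)
      then obtain x where x: "C - A = {x}" by (auto simp: card_1_singleton_iff)
      then have "C = insert x A" "x \<in> E' - A" using True CE by auto
      then show False using C by auto
    qed
    then obtain u where u: "u \<in> C" "u \<notin> E'" by auto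
    then have "?d C u = 0"
      using assms C' by (subst rows_det_in_order_eq_0_iff) auto
    then have "(\<Prod>u\<in>?G - E'. ?d C u) = 0"
      using u C' by (intro prod_zero) auto
    then show ?thesis by (simp add: M_entry_def)
  qed (simp add: M_entry_def)
  have entry: "row_weight k gs (insert x A) * M_entry k gs (insert x A) (A, E') =
      (\<Prod>u\<in>E' - insert x A. inverse (?d (insert x A) u))" if x: "x \<in> E' - A" for x
  proof -
    let ?C = "insert x A"
    have C: "?C \<subseteq> ?G" "Suc (card ?C) = k" "?C \<subseteq> E'" using x E' finE assms(3) by auto
    have nz: "?d ?C u \<noteq> 0" if "u \<in> ?G - E'" for u
      using that C assms rows_det_in_order_eq_0_iff[of k gs ?C u] by auto
    have "?G - ?C = (E' - ?C) \<union> (?G - E')" using C E' by auto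
    then have "row_weight k gs ?C =
        (\<Prod>u\<in>E' - ?C. inverse (?d ?C u)) * (\<Prod>u\<in>?G - E'. inverse (?d ?C u))"
      unfolding row_weight_def using finE C by (simp only:) (rule prod.union_disjoint; auto)
    moreover have "M_entry k gs ?C (A, E') = (\<Prod>u\<in>?G - E'. ?d ?C u)"
      using x by (auto simp: M_entry_def)
    moreover have "(\<Prod>u\<in>?G - E'. inverse (?d ?C u)) * (\<Prod>u\<in>?G - E'. ?d ?C u) = 1"
      unfolding prod.distrib[symmetric] using nz by (intro prod.neutral) auto
    ultimately show ?thesis by (simp add: mult.assoc)
  qed
  have "finite (M_rows k ?G)" by (simp add: M_rows_def)
  then have "(\<Sum>C\<in>M_rows k ?G. p C * row_weight k gs C * M_entry k gs C (A, E')) =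
      (\<Sum>C\<in>?I. p C * row_weight k gs C * M_entry k gs C (A, E'))"
    using I zero by (intro sum.mono_neutral_right) auto
  also have "\<dots> = (\<Sum>x\<in>E' - A. p (insert x A) * row_weight k gs (insert x A) *
      M_entry k gs (insert x A) (A, E'))"
  proof -
    have "inj_on (\<lambda>x. insert x A) (E' - A)" by (auto simp: inj_on_def)
    then show ?thesis by (simp add: sum.reindex)
  qed
  also have "\<dots> = (\<Sum>x\<in>E' - A. p (insert x A) *
      (\<Prod>u\<in>E' - insert x A. inverse (?d (insert x A) u)))"
    using entry by (intro sum.cong) (simp_all add: mult.assoc)
  also have "\<dots> = 0" using tangent_relationD[OF rel E'] .
  finally show ?thesis .
qed

lemma row_weight_nonzero:
  fixes gs :: "'a::field vec list"
  assumes "arc k (set gs)" "distinct gs" "1 \<le> k" "C \<in> M_rows k (set gs)"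
  shows "row_weight k gs C \<noteq> 0"
  using assms rows_det_in_order_eq_0_iff[of k gs C]
  by (auto simp: row_weight_def M_rows_def)

text \<open>Every vector of the column space is orthogonal to the weighted solution; with support of
  size two this is a two-term relation, which fixes the ratio of \<open>p C1\<close> to
  \<open>p C2\<close> independently of \<open>p\<close>.\<close>

lemma property_W_pair:
  fixes gs :: "'a::field vec list"
  assumes "arc k (set gs)" "distinct gs" "2 \<le> k" "k + t + n = card (set gs)"
    and rel: "tangent_relation k t gs p"
    and v: "v \<in> M_column_space k gs n" "{C. v C \<noteq> 0} = {C1, C2}" "C1 \<noteq> C2"
  shows "p C1 * row_weight k gs C1 * v C1 + p C2 * row_weight k gs C2 * v C2 = 0"
proof -
  let ?R = "M_rows k (set gs)" and ?J = "M_cols k (set gs) n"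
  obtain c where c: "\<And>C. v C = (if C \<in> ?R then \<Sum>j\<in>?J. c j * M_entry k gs C j else 0)"
    using v(1) unfolding M_column_space_def by blast
  have fin: "finite ?R" by (simp add: M_rows_def)
  have sub: "{C1, C2} \<subseteq> ?R" unfolding v(2)[symmetric] by (auto simp: c)
  have "(\<Sum>C\<in>?R. p C * row_weight k gs C * v C) =
      (\<Sum>C\<in>?R. \<Sum>j\<in>?J. c j * (p C * row_weight k gs C * M_entry k gs C j))"
    by (intro sum.cong) (auto simp: c sum_distrib_left mult_ac)
  also have "\<dots> = (\<Sum>j\<in>?J. c j * (\<Sum>C\<in>?R. p C * row_weight k gs C * M_entry k gs C j))"
    by (subst sum.swap) (simp add: sum_distrib_left)
  also have "\<dots> = 0"
  proof (intro sum.neutral ballI)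
    fix j assume j: "j \<in> ?J"
    obtain A E' where "j = (A, E')" by (cases j)
    then show "c j * (\<Sum>C\<in>?R. p C * row_weight k gs C * M_entry k gs C j) = 0"
      using M_left_kernel[OF assms(1-5)] j by simp
  qed
  finally have "(\<Sum>C\<in>?R. p C * row_weight k gs C * v C) = 0" .
  moreover have "(\<Sum>C\<in>{C1, C2}. p C * row_weight k gs C * v C) =
      (\<Sum>C\<in>?R. p C * row_weight k gs C * v C)"
    using fin sub v(2) by (intro sum.mono_neutral_left) auto
  ultimately show ?thesis using v(3) by simp
qed

text \<open>Both solutions are compared through the quotient \<open>h\<close>. It is constant over
  each fixed \<open>A\<close>, and Johnson neighbours share such an \<open>A\<close>.\<close>

lemma tangent_relation_unique:
  fixes gs :: "'a::field vec list"
  assumes "arc k (set gs)" "distinct gs" "2 \<le> k" "k + t + n = card (set gs)"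
    and W: "property_W k gs n"
    and rel: "tangent_relation k t gs p" "tangent_relation k t gs p'"
    and nz: "\<And>C. C \<in> M_rows k (set gs) \<Longrightarrow> p C \<noteq> 0 \<and> p' C \<noteq> 0"
  shows "\<exists>c. c \<noteq> 0 \<and> (\<forall>C\<in>M_rows k (set gs). p C = c * p' C)"
proof -
  let ?G = "set gs" and ?d = "\<lambda>C u. rows_det k (u # in_order gs C)"
  define h where "h = (\<lambda>C. p C / p' C)"
  have ex: "\<exists>c. \<forall>y\<in>?G - A. h (insert y A) = c" if A: "A \<subseteq> ?G" "card A = k - 2" for A
  proof -
    have finA: "finite A" using A(1) by (rule finite_subset) simp
    from W[unfolded property_W_def, THEN spec, THEN mp, OF conjI[OF A]]
    obtain C CC where C: "insert C CC \<subseteq> {C' \<in> M_rows k ?G. A \<subseteq> C'}" "C \<notin> CC"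
        "card CC = card ?G - n - k + 1"
        "\<forall>Ci\<in>CC. \<exists>v\<in>M_column_space k gs n. {C'. v C' \<noteq> 0} = {C, Ci}"
      by (elim exE conjE) (rule that)
    have hC: "h Ci = h C" if Ci: "Ci \<in> CC" for Ci
    proof -
      obtain v where v: "v \<in> M_column_space k gs n" "{C'. v C' \<noteq> 0} = {C, Ci}"
        using C(4) Ci by blast
      have ne: "C \<noteq> Ci" using C(2) Ci by auto
      have v0: "v C \<noteq> 0" "v Ci \<noteq> 0" using v(2) by auto
      have R: "C \<in> M_rows k ?G" "Ci \<in> M_rows k ?G" using C(1) Ci by auto
      have w0: "row_weight k gs C \<noteq> 0" "row_weight k gs Ci \<noteq> 0"
        using row_weight_nonzero[of k gs] assms(1-3) R by auto
      define a b where "a = row_weight k gs C * v C" and "b = row_weight k gs Ci * v Ci"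
      have "p C * a + p Ci * b = 0" "p' C * a + p' Ci * b = 0"
        using property_W_pair[OF assms(1-4) rel(1) v ne] property_W_pair[OF assms(1-4) rel(2) v ne]
        by (simp_all add: a_def b_def mult.assoc)
      then have "p Ci * b = - (p C * a)" "p' Ci * b = - (p' C * a)"
        by (simp_all add: eq_neg_iff_add_eq_0 add.commute)
      then have "p Ci * b * (p' C * a) = p' Ci * b * (p C * a)" by simp
      moreover have "a \<noteq> 0" "b \<noteq> 0" using v0 w0 by (auto simp: a_def b_def)
      ultimately have "p Ci * p' C = p C * p' Ci" by (simp add: mult_ac)
      then show ?thesis using nz[OF R(1)] nz[OF R(2)] by (simp add: h_def frac_eq_eq mult.commute)
    qed
    define c where "c = h C"
    define T where "T = {x \<in> ?G - A. h (insert x A) = c}"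
    have "insert C CC \<subseteq> (\<lambda>x. insert x A) ` T"
    proof
      fix C' assume C': "C' \<in> insert C CC"
      have C'': "C' \<subseteq> ?G" "card C' = k - 1" "A \<subseteq> C'" using C(1) C' by (auto simp: M_rows_def)
      have "card (C' - A) = 1" using C'' A finA assms(3) by (simp add: card_Diff_subset)
      then obtain x where x: "C' - A = {x}" by (auto simp: card_1_singleton_iff)
      then have "C' = insert x A" "x \<in> ?G - A" using C'' by auto
      moreover have "h C' = c" using C' hC c_def by auto
      ultimately show "C' \<in> (\<lambda>x. insert x A) ` T" unfolding T_def by auto
    qed
    moreover have finT: "finite T" by (simp add: T_def)
    ultimately have "card (insert C CC) \<le> card T" using surj_card_le by blast
    moreover have "finite CC" using C(3) by (intro card_ge_0_finite) simp
    ultimately have "t + 2 \<le> card T" using C(2,3) assms(4) by simp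
    \<comment> \<open>One point fewer than \<open>T\<close> offers: together with a new point
      \<open>y\<close> this gives the t + 2 points of one interpolation relation.\<close>
    then obtain T' where T': "T' \<subseteq> T" "card T' = t + 1"
      by (meson Suc_leD add_leD1 obtain_subset_with_card_n le_trans add_le_mono order_refl one_le_numeral)
    have finT': "finite T'" using T'(1) finT by (rule finite_subset)
    have "h (insert y A) = c" if y: "y \<in> ?G - A" for y
    proof (cases "y \<in> T")
      case False
      define E' where "E' = A \<union> insert y T'"
      have dis: "A \<inter> insert y T' = {}" "y \<notin> T'" using y T' False by (auto simp: T_def)
      then have "card E' = k + t"
        unfolding E'_def using finA finT' A T' assms(3) by (simp add: card_Un_disjoint)
      moreover have E'G: "E' \<subseteq> ?G" "A \<subseteq> E'" using A T' y by (auto simp: E'_def T_def)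
      ultimately have r: "(\<Sum>x\<in>E' - A. P (insert x A) * (\<Prod>u\<in>E' - insert x A. inverse (?d (insert x A) u))) = 0"
        if "tangent_relation k t gs P" for P
        using tangent_relationD[OF that] A(2) by blast
      have EA: "E' - A = insert y T'" using dis by (auto simp: E'_def)
      let ?w = "\<lambda>x. \<Prod>u\<in>E' - insert x A. inverse (?d (insert x A) u)"
      \<comment> \<open>The relation is linear, so it holds for \<open>p - c p'\<close>. This
        difference vanishes over \<open>T'\<close>, and the surviving term at \<open>y\<close> has
        nonzero weight.\<close>
      have "(\<Sum>x\<in>E' - A. (p (insert x A) - c * p' (insert x A)) * ?w x) =
        (\<Sum>x\<in>E' - A. p (insert x A) * ?w x) - c * (\<Sum>x\<in>E' - A. p' (insert x A) * ?w x)"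
        by (simp add: sum_subtractf sum_distrib_left left_diff_distrib mult.assoc)
      also have "\<dots> = 0" using r[OF rel(1)] r[OF rel(2)] by simp
      also have "(\<Sum>x\<in>E' - A. (p (insert x A) - c * p' (insert x A)) * ?w x) =
        (p (insert y A) - c * p' (insert y A)) * ?w y +
        (\<Sum>x\<in>T'. (p (insert x A) - c * p' (insert x A)) * ?w x)"
        unfolding EA using finT' dis by (simp add: sum.insert)
      also have "(\<Sum>x\<in>T'. (p (insert x A) - c * p' (insert x A)) * ?w x) = 0"
      proof (intro sum.neutral ballI)
        fix x assume "x \<in> T'"
        then have x: "x \<in> ?G - A" "h (insert x A) = c" using T' by (auto simp: T_def)
        then have "insert x A \<in> M_rows k ?G" using A finA assms(3) by (auto simp: M_rows_def)
        then have "p (insert x A) = c * p' (insert x A)" using nz x(2) by (auto simp: h_def)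
        then show "(p (insert x A) - c * p' (insert x A)) * ?w x = 0" by simp
      qed
      finally have "(p (insert y A) - c * p' (insert y A)) * ?w y = 0" by simp
      moreover have yR: "insert y A \<in> M_rows k ?G" using y A finA assms(3) by (auto simp: M_rows_def)
      moreover have "?w y \<noteq> 0"
        using yR assms(1-3) E'G rows_det_in_order_eq_0_iff[of k gs "insert y A"] finT' finA
        by (auto simp: E'_def M_rows_def)
      ultimately have "p (insert y A) = c * p' (insert y A)" by simp
      then show ?thesis using nz[OF yR] by (simp add: h_def)
    qed (simp add: T_def)
    then show ?thesis by blast
  qed
  have const: "h C = h C'" if "C \<in> M_rows k ?G" "C' \<in> M_rows k ?G" for C C'
  proof (rule johnson_connected[of ?G "k - 2"])
    fix A x y assume "A \<subseteq> ?G" "card A = k - 2" "x \<in> ?G - A" "y \<in> ?G - A"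
    then show "h (insert x A) = h (insert y A)" using ex[of A] by metis
  qed (use that assms(3) in \<open>auto simp: M_rows_def\<close>)
  show ?thesis
  proof (cases "M_rows k ?G = {}")
    case True
    then show ?thesis by (intro exI[of _ 1]) simp
  next
    case False
    then obtain C0 where C0: "C0 \<in> M_rows k ?G" by auto
    show ?thesis
    proof (intro exI[of _ "h C0"] conjI ballI)
      show "h C0 \<noteq> 0" using nz[OF C0] by (simp add: h_def)
      fix C assume C: "C \<in> M_rows k ?G"
      have "h C = h C0" using const C C0 by blast
      then show "p C = h C0 * p' C" using nz[OF C] by (simp add: h_def divide_eq_eq)
    qed
  qed
qed

section \<open>The lemma of tangents\<close>

text \<open>Forms vanishing on \<open>as\<close> are given by their values at \<open>y\<close> and
  \<open>z\<close>, so the ratio of these values determines the hyperplane.\<close>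

lemma rows_det_proportional:
  fixes a b :: "'a::field vec"
  assumes "length as + 2 = k" "set (y # z # as) \<subseteq> carrier_vec k" "rows_det k (y # z # as) \<noteq> 0"
    and "a \<in> carrier_vec k" "b \<in> carrier_vec k"
    and "\<And>u. u \<in> set as \<Longrightarrow> a \<bullet> u = 0" "\<And>u. u \<in> set as \<Longrightarrow> b \<bullet> u = 0"
    and "a \<bullet> y \<noteq> 0" "b \<bullet> y \<noteq> 0" "a \<bullet> z / (a \<bullet> y) = b \<bullet> z / (b \<bullet> y)"
  shows "a = ((a \<bullet> y) / (b \<bullet> y)) \<cdot>\<^sub>v b"
proof (rule rows_det_form_eqI[of "y # z # as" k])
  fix u assume "u \<in> set (y # z # as)"
  moreover have "(((a \<bullet> y) / (b \<bullet> y)) \<cdot>\<^sub>v b) \<bullet> u = ((a \<bullet> y) / (b \<bullet> y)) * (b \<bullet> u)"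
    if "u \<in> carrier_vec k" for u
    using that assms(5) by simp
  ultimately show "a \<bullet> u = (((a \<bullet> y) / (b \<bullet> y)) \<cdot>\<^sub>v b) \<bullet> u"
    using assms by (auto simp: field_simps)
qed (use assms in auto)

text \<open>Negation permutes the nonzero elements, so their product is unchanged by it. This treats
  both parities of q at once.\<close>

lemma minus_one_power_card_field: "(-1) ^ (CARD('a) - 1) = (1 :: 'a::{field, finite})"
proof -
  let ?U = "UNIV - {0 :: 'a}"
  have "\<Prod>?U = (\<Prod>x\<in>?U. - x)"
    by (rule prod.reindex_bij_witness[of _ uminus uminus]) auto
  also have "\<dots> = (-1) ^ card ?U * \<Prod>?U" by (rule prod_uminus)
  finally have "(-1) ^ card ?U = (1 :: 'a)" by (simp add: prod_nonzero_finite_field)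
  then show ?thesis by (simp add: card_Diff_singleton)
qed

text \<open>\<open>card_S\<close> is t = q + k - 1 - |S| written without truncated
  subtraction.\<close>

locale arc_tangents =
  fixes k t :: nat and ss :: "'a::{field, finite} vec list" and forms :: "'a vec set \<Rightarrow> 'a vec list"
  assumes k: "3 \<le> k" and arc: "arc k (set ss)" and dist: "distinct ss"
    and card_S: "card (set ss) + t + 1 = CARD('a) + k"
    and forms: "tangent_forms k t (set ss) forms"
begin

abbreviation "S \<equiv> set ss"
abbreviation "f \<equiv> tangent_fun forms"

lemma S_carrier: "u \<in> S \<Longrightarrow> u \<in> carrier_vec k"
  using arc by (auto simp: arc_def)

lemma formsD:
  assumes "A \<subseteq> S" "card A = k - 2"
  shows "length (forms A) = t" "distinct (forms A)" "set (forms A) \<subseteq> carrier_vec k"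
    and "\<And>a u. a \<in> set (forms A) \<Longrightarrow> u \<in> S \<Longrightarrow> a \<bullet> u = 0 \<longleftrightarrow> u \<in> A"
    and "\<And>a b. a \<in> set (forms A) \<Longrightarrow> b \<in> set (forms A) \<Longrightarrow> a \<noteq> b \<Longrightarrow>
      \<not> module.lin_dep class_ring (module_vec TYPE('a) k) {a, b}"
proof -
  note * = forms[unfolded tangent_forms_def, rule_format, OF conjI[OF assms]]
  show "length (forms A) = t" "distinct (forms A)" "set (forms A) \<subseteq> carrier_vec k"
    using * by auto
  show "a \<bullet> u = 0 \<longleftrightarrow> u \<in> A" if "a \<in> set (forms A)" "u \<in> S" for a u
  proof -
    have "{x \<in> S. a \<bullet> x = 0} = A" using * that(1) by blast
    then show ?thesis using that(2) by blast
  qed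
  show "\<not> module.lin_dep class_ring (module_vec TYPE('a) k) {a, b}"
    if "a \<in> set (forms A)" "b \<in> set (forms A)" "a \<noteq> b" for a b
    using * that by (auto simp: pairwise_def)
qed

lemma f_eq_prod:
  assumes "A \<subseteq> S" "card A = k - 2"
  shows "f A x = (\<Prod>a\<in>set (forms A). a \<bullet> x)"
  using formsD(2)[OF assms] by (simp add: tangent_fun_def prod.distinct_set_conv_list)

lemma f_nonzero:
  assumes "A \<subseteq> S" "card A = k - 2" "x \<in> S - A"
  shows "f A x \<noteq> 0"
  using assms formsD(4)[OF assms(1,2)] by (auto simp: f_eq_prod)

lemma rows_det_zero_iff:
  assumes "length us = k" "set us \<subseteq> S"
  shows "rows_det k us = 0 \<longleftrightarrow> \<not> distinct us"
  using assms arc arc_rows_det_nonzero[of k S us] rows_det_not_distinct[of us k] by blast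

text \<open>The hyperplanes through \<open>A\<close> other than \<open>A \<union> {y}\<close> and \<open>A \<union> {z}\<close> are told apart by the
  ratio of their values at \<open>z\<close> and \<open>y\<close>. The tangents and the hyperplanes through a further point
  of \<open>S\<close> number \<open>q - 1\<close>, so these ratios are all the nonzero field elements.\<close>
lemma tangent_product:
  assumes "set as \<subseteq> S" "distinct as" "length as + 2 = k"
    and "y \<in> S - set as" "z \<in> S - set as" "y \<noteq> z"
  shows "(\<Prod>s\<in>S - set as - {y, z}. rows_det k (z # s # as) / rows_det k (y # s # as)) *
    (f (set as) z / f (set as) y) = -1"
proof -
  let ?A = "set as"
  let ?T = "set (forms ?A)"
  let ?Q = "S - ?A - {y, z}"
  have A: "?A \<subseteq> S" "card ?A = k - 2" using assms by (auto simp: distinct_card)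
  note F = formsD[OF A]
  \<comment> \<open>\<open>B s\<close> will be the coefficient vector of the hyperplane spanned by
    \<open>as\<close> and the further point \<open>s\<close>.\<close>
  have "\<forall>s. \<exists>b. b \<in> carrier_vec k \<and> (\<forall>v\<in>carrier_vec k. rows_det k (v # s # as) = b \<bullet> v)"
  proof
    fix s
    show "\<exists>b. b \<in> carrier_vec k \<and> (\<forall>v\<in>carrier_vec k. rows_det k (v # s # as) = b \<bullet> v)"
      using rows_det_linear_form[of "s # as" k] assms(3) by auto
  qed
  from choice[OF this] obtain B where B: "\<And>s. B s \<in> carrier_vec k"
    "\<And>s v. v \<in> carrier_vec k \<Longrightarrow> B s \<bullet> v = rows_det k (v # s # as)" by force
  have BS: "B s \<bullet> v = 0 \<longleftrightarrow> v = s \<or> v \<in> ?A" if "s \<in> ?Q" "v \<in> S" for s v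
  proof -
    have "B s \<bullet> v = rows_det k (v # s # as)" using B(2) S_carrier that(2) by blast
    then show ?thesis using that assms rows_det_zero_iff[of "v # s # as"] by auto
  qed
  define r where "r = (\<lambda>a. (a \<bullet> z) / (a \<bullet> y))"
  have prp: "a = ((a \<bullet> y) / (b \<bullet> y)) \<cdot>\<^sub>v b"
    if "a \<in> ?T \<union> B ` ?Q" "b \<in> ?T \<union> B ` ?Q" "r a = r b" for a b
  proof (rule rows_det_proportional[of as k y z])
    have van: "c \<in> carrier_vec k \<and> (\<forall>u\<in>?A. c \<bullet> u = 0) \<and> c \<bullet> y \<noteq> 0"
      if "c \<in> ?T \<union> B ` ?Q" for c
      using that F(3,4) B(1) BS assms(1,4) by blast
    show "a \<in> carrier_vec k" "b \<in> carrier_vec k" "a \<bullet> y \<noteq> 0" "b \<bullet> y \<noteq> 0"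
      "\<And>u. u \<in> ?A \<Longrightarrow> a \<bullet> u = 0" "\<And>u. u \<in> ?A \<Longrightarrow> b \<bullet> u = 0"
      using van[OF that(1)] van[OF that(2)] by blast+
    show "rows_det k (y # z # as) \<noteq> 0"
      using assms rows_det_zero_iff[of "y # z # as"] by auto
    show "set (y # z # as) \<subseteq> carrier_vec k" using assms S_carrier by auto
  qed (use that(3) assms(3) in \<open>simp_all add: r_def\<close>)
  \<comment> \<open>Equal ratios mean proportional forms, hence the same zeros in S. This separates
    the spanned hyperplanes from each other and from the tangents: \<open>B s\<close> vanishes at
    \<open>s\<close>, the other forms do not.\<close>
  have zero_iff: "a \<bullet> u = 0 \<longleftrightarrow> b \<bullet> u = 0"
    if "a \<in> ?T \<union> B ` ?Q" "b \<in> ?T \<union> B ` ?Q" "r a = r b" "u \<in> S" for a b u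
  proof -
    have *: "a = ((a \<bullet> y) / (b \<bullet> y)) \<cdot>\<^sub>v b" "b = ((b \<bullet> y) / (a \<bullet> y)) \<cdot>\<^sub>v a"
      using prp[OF that(1-3)] prp[OF that(2,1) that(3)[symmetric]] by blast+
    have c: "a \<in> carrier_vec k" "b \<in> carrier_vec k" "u \<in> carrier_vec k"
      using that F(3) B(1) S_carrier by auto
    have "a \<bullet> u = ((a \<bullet> y) / (b \<bullet> y)) * (b \<bullet> u)"
      by (subst *(1)) (rule smult_scalar_prod_distrib[OF c(2,3)])
    moreover have "b \<bullet> u = ((b \<bullet> y) / (a \<bullet> y)) * (a \<bullet> u)"
      by (subst *(2)) (rule smult_scalar_prod_distrib[OF c(1,3)])
    ultimately show ?thesis by auto
  qed
  have injT: "inj_on r ?T"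
  proof (rule inj_onI, rule ccontr)
    fix a b assume ab: "a \<in> ?T" "b \<in> ?T" "r a = r b" "a \<noteq> b"
    then have "module.lin_dep class_ring (module_vec TYPE('a) k) {a, b}"
      using prp[of a b] F(3) by (intro lin_dep_smult_pair[of a k b]) auto
    then show False using F(5) ab by blast
  qed
  have injQ: "inj_on (\<lambda>s. r (B s)) ?Q"
  proof (rule inj_onI)
    fix s s' assume s: "s \<in> ?Q" "s' \<in> ?Q" "r (B s) = r (B s')"
    have "B s \<bullet> s = 0 \<longleftrightarrow> B s' \<bullet> s = 0" using s by (intro zero_iff) auto
    then show "s = s'" using BS[of s s] BS[of s' s] s by auto
  qed
  have disj: "r ` ?T \<inter> (\<lambda>s. r (B s)) ` ?Q = {}"
  proof (rule ccontr)
    assume "r ` ?T \<inter> (\<lambda>s. r (B s)) ` ?Q \<noteq> {}"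
    then obtain a s where as: "a \<in> ?T" "s \<in> ?Q" "r a = r (B s)" by auto
    have "a \<bullet> s = 0 \<longleftrightarrow> B s \<bullet> s = 0" using as by (intro zero_iff) auto
    then show False using BS[of s s] F(4)[of a s] as by auto
  qed
  let ?V = "r ` ?T \<union> (\<lambda>s. r (B s)) ` ?Q"
  have "?V \<subseteq> UNIV - {0}"
    using F(4) BS assms(4-6) by (auto simp: r_def)
  \<comment> \<open>There are t tangents and |S| - k points \<open>s\<close>, together q - 1
    distinct ratios.\<close>
  moreover have "card ?V = card (UNIV - {0 :: 'a})"
  proof -
    have "card ?V = card ?T + card ?Q"
      using disj injT injQ by (simp add: card_Un_disjoint card_image)
    moreover have "card ?T = t" using F(1,2) by (simp add: distinct_card)
    moreover have "card ?Q = card S - card (insert y (insert z ?A))"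
      using assms by (subst card_Diff_subset[symmetric]) (auto intro!: arg_cong[where f = card])
    moreover have "card (insert y (insert z ?A)) = k" "k \<le> card S"
    proof -
      show *: "card (insert y (insert z ?A)) = k" using assms by (simp add: distinct_card)
      show "k \<le> card S" unfolding *[symmetric] using assms by (intro card_mono) auto
    qed
    ultimately show ?thesis using card_S by (simp add: card_Diff_singleton)
  qed
  ultimately have "?V = UNIV - {0}" by (intro card_subset_eq) auto
  then have "-1 = \<Prod>?V" using prod_nonzero_finite_field[where 'a = 'a] by simp
  also have "\<dots> = (\<Prod>a\<in>?T. r a) * (\<Prod>s\<in>?Q. r (B s))"
    using disj injT injQ by (simp add: prod.union_disjoint prod.reindex)
  also have "(\<Prod>a\<in>?T. r a) = f ?A z / f ?A y"
    by (simp add: f_eq_prod[OF A] r_def prod_dividef)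
  also have "(\<Prod>s\<in>?Q. r (B s)) = (\<Prod>s\<in>?Q. rows_det k (z # s # as) / rows_det k (y # s # as))"
    using assms(4,5) S_carrier by (simp add: r_def B(2))
  finally show ?thesis by (simp add: mult.commute)
qed

text \<open>Multiply the three instances of \<open>tangent_product\<close> over D + x, D + y and D +
  z. The determinants cancel up to one sign for each further point of S, and the number of these
  points decides the total sign.\<close>

lemma segre_lemma_of_tangents:
  assumes "D \<subseteq> S" "card D + 3 = k" "x \<in> S - D" "y \<in> S - D" "z \<in> S - D" "x \<noteq> y" "y \<noteq> z" "x \<noteq> z"
  shows "f (insert x D) y * f (insert y D) z * f (insert z D) x =
    (-1) ^ (t + 1) * (f (insert y D) x * f (insert z D) y * f (insert x D) z)"
proof -
  have finD: "finite D" using assms(1) by (rule finite_subset) simp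
  then obtain ds where ds: "set ds = D" "distinct ds" using finite_distinct_list by auto
  have len: "length ds + 3 = k" using ds assms(2) by (simp add: distinct_card[symmetric])
  define R where "R = S - D - {x, y, z}"
  define d where "d = (\<lambda>u s v. rows_det k (u # s # v # ds))"
  have e: "(\<Prod>s\<in>R. d z s x / d y s x) * (f (insert x D) z / f (insert x D) y) = -1"
    "(\<Prod>s\<in>R. d x s y / d z s y) * (f (insert y D) x / f (insert y D) z) = -1"
    "(\<Prod>s\<in>R. d y s z / d x s z) * (f (insert z D) y / f (insert z D) x) = -1"
  proof -
    have R: "S - set (x # ds) - {y, z} = R" "S - set (y # ds) - {z, x} = R"
      "S - set (z # ds) - {x, y} = R" unfolding R_def using ds by auto
    show "(\<Prod>s\<in>R. d z s x / d y s x) * (f (insert x D) z / f (insert x D) y) = -1"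
      using tangent_product[of "x # ds" y z] ds len assms unfolding R by (simp add: d_def)
    show "(\<Prod>s\<in>R. d x s y / d z s y) * (f (insert y D) x / f (insert y D) z) = -1"
      using tangent_product[of "y # ds" z x] ds len assms unfolding R by (simp add: d_def)
    show "(\<Prod>s\<in>R. d y s z / d x s z) * (f (insert z D) y / f (insert z D) x) = -1"
      using tangent_product[of "z # ds" x y] ds len assms unfolding R by (simp add: d_def)
  qed
  have swap: "d u s v = - d v s u" for u s v
  proof -
    have "d u s v = - d s u v"
      using rows_det_swap[of "[]" "v # ds" k u s] len by (simp add: d_def)
    also have "d s u v = - d s v u"
      using rows_det_swap[of "[s]" ds k u v] len by (simp add: d_def)
    also have "d s v u = - d v s u"
      using rows_det_swap[of "[]" "u # ds" k s v] len by (simp add: d_def)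
    finally show ?thesis by simp
  qed
  \<comment> \<open>Each determinant in a numerator returns in a denominator with its outer vectors
    exchanged; three such exchanges give -1.\<close>
  have dR: "(d z s x / d y s x) * (d x s y / d z s y) * (d y s z / d x s z) = -1" if s: "s \<in> R" for s
  proof -
    have nz: "d x s z \<noteq> 0" "d x s y \<noteq> 0" "d y s z \<noteq> 0"
      unfolding d_def using s assms ds len by (subst rows_det_zero_iff; auto simp: R_def)+
    show ?thesis using nz by (simp add: swap[of z s x] swap[of y s x] swap[of z s y])
  qed
  define F1 F2 where "F1 = f (insert x D) y * f (insert y D) z * f (insert z D) x"
    and "F2 = f (insert y D) x * f (insert z D) y * f (insert x D) z"
  have "(\<Prod>s\<in>R. (d z s x / d y s x) * (d x s y / d z s y) * (d y s z / d x s z)) * (F2 / F1) =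
    ((\<Prod>s\<in>R. d z s x / d y s x) * (f (insert x D) z / f (insert x D) y)) *
    ((\<Prod>s\<in>R. d x s y / d z s y) * (f (insert y D) x / f (insert y D) z)) *
    ((\<Prod>s\<in>R. d y s z / d x s z) * (f (insert z D) y / f (insert z D) x))"
    unfolding prod.distrib F1_def F2_def by simp
  also have "\<dots> = -1" unfolding e by simp
  also have "(\<Prod>s\<in>R. (d z s x / d y s x) * (d x s y / d z s y) * (d y s z / d x s z)) = (-1) ^ card R"
    using dR by simp
  finally have main: "(-1) ^ card R * (F2 / F1) = -1" .
  then have "F1 \<noteq> 0" by auto
  then have main': "(-1) ^ card R * F2 = - F1" using main by (simp add: field_simps)
  \<comment> \<open>|R| = |S| - k = q - 1 - t, so (-1)^|R| = (-1)^t in the field.\<close>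
  have "card R + t = CARD('a) - 1"
  proof -
    have "R = S - (insert x (insert y (insert z D)))" by (auto simp: R_def)
    moreover have c: "card (insert x (insert y (insert z D))) = k" using assms finD by simp
    moreover have "k \<le> card S" unfolding c[symmetric] using assms by (intro card_mono) auto
    ultimately show ?thesis
      using assms card_S by (simp add: card_Diff_subset finD)
  qed
  then have "(-1) ^ card R * (-1) ^ t = (1 :: 'a)"
    using minus_one_power_card_field[where 'a = 'a] by (simp add: power_add[symmetric])
  then have "F1 = (-1) ^ card R * (-1) ^ t * F1" by simp
  also have "\<dots> = - ((-1) ^ t * ((-1) ^ card R * ((-1) ^ card R * F2)))" unfolding main' by simp
  also have "\<dots> = (-1) ^ (t + 1) * F2"
    by (simp add: mult.assoc[symmetric] power_add[symmetric])
  finally show ?thesis unfolding F1_def F2_def .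
qed

end

section \<open>The coefficients as a potential\<close>

definition before :: "'b list \<Rightarrow> 'b \<Rightarrow> 'b set" where
  "before xs x = set (takeWhile (\<lambda>y. y \<noteq> x) xs)"

lemma before_total:
  assumes "x \<in> set xs" "y \<in> set xs" "x \<noteq> y"
  shows "x \<in> before xs y \<longleftrightarrow> y \<notin> before xs x"
  using assms(1,2)
proof (induction xs)
  case (Cons a xs)
  consider "a = x" | "a = y" | "a \<noteq> x" "a \<noteq> y" by blast
  then show ?case using Cons assms(3) by cases (simp_all add: before_def)
qed simp

lemma in_order_insert:
  assumes "distinct xs" "x \<in> set xs" "x \<notin> A"
  obtains as bs where "in_order xs (insert x A) = as @ x # bs" "in_order xs A = as @ bs"
    "length as = card (A \<inter> before xs x)"
proof -
  obtain us vs where xs: "xs = us @ x # vs" using assms(2) by (meson split_list)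
  then have d: "x \<notin> set us" "x \<notin> set vs" "distinct us" using assms(1) by auto
  have ins: "in_order ws (insert x A) = in_order ws A" if "x \<notin> set ws" for ws
    using that unfolding in_order_def by (intro filter_cong) auto
  have "takeWhile (\<lambda>y. y \<noteq> x) xs = us"
    unfolding xs using d by (subst takeWhile_append2) auto
  then have "card (A \<inter> before xs x) = card (set (in_order us A))"
    by (simp add: before_def Int_commute)
  also have "\<dots> = length (in_order us A)" using d by (intro distinct_card) simp
  finally have "length (in_order us A) = card (A \<inter> before xs x)" by simp
  moreover have "in_order xs (insert x A) = in_order us (insert x A) @ x # in_order vs (insert x A)"
    "in_order xs A = in_order us A @ in_order vs A"
    using assms(3) by (simp_all add: xs in_order_def)
  ultimately show thesis using that ins d by metis
qed

text \<open>Moving \<open>x\<close> from its sorted place to the front passes exactly the elements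
  of \<open>A\<close> that precede it, one row swap each.\<close>

lemma rows_det_in_order_insert:
  fixes xs :: "'a::comm_ring_1 vec list"
  assumes "distinct xs" "x \<in> set xs" "x \<notin> A" "A \<subseteq> set xs" "card A + 2 = k"
  shows "rows_det k (u # in_order xs (insert x A)) =
    (-1) ^ card (A \<inter> before xs x) * rows_det k (u # x # in_order xs A)"
proof -
  obtain as bs where *: "in_order xs (insert x A) = as @ x # bs" "in_order xs A = as @ bs"
    "length as = card (A \<inter> before xs x)"
    using in_order_insert[OF assms(1-3)] by blast
  have "length (as @ bs) = card A"
    unfolding *(2)[symmetric] using assms by (intro length_in_order) auto
  then show ?thesis
    using rows_det_move_to_front[of "[u]" as bs k x] assms(5) * by simp
qed

lemma in_order_prefix:
  assumes "prefix gs xs" "distinct xs" "X \<subseteq> set gs"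
  shows "in_order xs X = in_order gs X"
proof -
  obtain rest where "xs = gs @ rest" using assms(1) by (auto simp: prefix_def)
  moreover have "in_order rest X = []"
    using assms calculation by (auto simp: in_order_def filter_empty_conv)
  ultimately show ?thesis by (simp add: in_order_def)
qed

text \<open>Brings the relation from S down to G: subsets of an initial segment are ordered alike in
  both lists, and fewer sets E' are involved.\<close>

lemma tangent_relation_prefix:
  assumes "tangent_relation k t xs p" "prefix gs xs" "distinct xs" "2 \<le> k"
  shows "tangent_relation k t gs p"
  unfolding tangent_relation_def
proof (intro allI impI)
  fix A E' assume *: "E' \<subseteq> set gs \<and> card E' = k + t \<and> A \<subseteq> E' \<and> card A = k - 2"
  have "set gs \<subseteq> set xs" using assms(2) by (auto simp: prefix_def)
  then have "(\<Sum>x\<in>E' - A. p (insert x A) *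
    (\<Prod>u\<in>E' - insert x A. inverse (rows_det k (u # in_order xs (insert x A))))) = 0"
    using * by (intro tangent_relationD[OF assms(1)]) auto
  moreover have "in_order xs (insert x A) = in_order gs (insert x A)" if "x \<in> E' - A" for x
    using * that by (intro in_order_prefix[OF assms(2,3)]) auto
  ultimately show "(\<Sum>x\<in>E' - A. p (insert x A) *
    (\<Prod>u\<in>E' - insert x A. inverse (rows_det k (u # in_order gs (insert x A))))) = 0"
    by simp
qed

context arc_tangents
begin

definition sg :: "'a vec set \<Rightarrow> 'a vec \<Rightarrow> nat" where
  "sg A x = card (A \<inter> before ss x)"

text \<open>The sign turns Segre's lemma into the sign-free triangle condition of
  \<open>exchange_potential_exists\<close> and cancels the sign of \<open>rows_det_in_order_insert\<close>.\<close>
definition g :: "'a vec set \<Rightarrow> 'a vec \<Rightarrow> 'a" where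
  "g A x = (-1) ^ ((t + 1) * sg A x) * f A x"

lemma g_square: "(g A x)\<^sup>2 = (f A x)\<^sup>2"
  by (simp add: g_def power_mult_distrib flip: power_mult)

lemma g_nonzero: "A \<subseteq> S \<Longrightarrow> card A = k - 2 \<Longrightarrow> x \<in> S - A \<Longrightarrow> g A x \<noteq> 0"
  using f_nonzero by (simp add: g_def)

text \<open>Adjoining \<open>u\<close> to D raises \<open>sg D v\<close> by one exactly if
  \<open>u\<close> precedes \<open>v\<close>. For each pair among x, y, z exactly one of the two
  orders occurs, so the six counts have an odd sum, and their sign (-1)^(t+1) cancels that of
  Segre's lemma.\<close>

lemma segre_signed:
  assumes "D \<subseteq> S" "card D + 3 = k" "x \<in> S - D" "y \<in> S - D" "z \<in> S - D" "x \<noteq> y" "y \<noteq> z" "x \<noteq> z"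
  shows "g (insert x D) y * g (insert y D) z * g (insert z D) x =
    g (insert y D) x * g (insert z D) y * g (insert x D) z"
proof -
  define b where "b = (\<lambda>u v. if u \<in> before ss v then 1 else 0 :: nat)"
  have fin: "finite D" using assms(1) by (rule finite_subset) simp
  have sg: "sg (insert u D) v = sg D v + b u v" if "u \<notin> D" for u v
    using that fin by (simp add: sg_def b_def)
  have b: "b u v + b v u = 1" if "u \<in> S" "v \<in> S" "u \<noteq> v" for u v
    using before_total[of u ss v] that by (auto simp: b_def)
  define L R where "L = sg (insert x D) y + sg (insert y D) z + sg (insert z D) x"
    and "R = sg (insert y D) x + sg (insert z D) y + sg (insert x D) z"
  have "L + R = 2 * (sg D x + sg D y + sg D z) + (b x y + b y x) + (b y z + b z y) + (b x z + b z x)"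
    unfolding L_def R_def using assms by (simp add: sg)
  then have "L + R = 2 * (sg D x + sg D y + sg D z) + 3"
    using b[of x y] b[of y z] b[of x z] assms by simp
  then have "odd (L + R)" by simp
  then have par: "(-1) ^ ((t + 1) * L + (t + 1)) = ((-1) ^ ((t + 1) * R) :: 'a)"
    by (simp add: minus_one_power_iff) blast
  have "g (insert x D) y * g (insert y D) z * g (insert z D) x =
      (-1) ^ ((t + 1) * L) * (f (insert x D) y * f (insert y D) z * f (insert z D) x)"
    by (simp add: g_def L_def distrib_left power_add)
  also have "\<dots> = (-1) ^ ((t + 1) * L + (t + 1)) *
      (f (insert y D) x * f (insert z D) y * f (insert x D) z)"
    unfolding segre_lemma_of_tangents[OF assms] power_add by simp
  also have "\<dots> = g (insert y D) x * g (insert z D) y * g (insert x D) z"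
    unfolding par by (simp add: g_def R_def distrib_left power_add)
  finally show ?thesis .
qed

lemma potential_exists: "\<exists>p. exchange_potential S (k - 2) g p"
proof (rule exchange_potential_exists)
  fix D x y z
  assume "D \<subseteq> S" "Suc (card D) = k - 2" "x \<in> S - D" "y \<in> S - D" "z \<in> S - D"
    "x \<noteq> y" "y \<noteq> z" "x \<noteq> z"
  then show "g (insert x D) y * g (insert y D) z * g (insert z D) x =
      g (insert y D) x * g (insert z D) y * g (insert x D) z"
    by (intro segre_signed) auto
qed (use g_nonzero in auto)

text \<open>The bracket of u and x is the determinant with rows u, x followed by A. The tangent
  forms vanish on A, so they satisfy the three-term relation with it.\<close>

lemma tangent_interpolation:
  assumes "A \<subseteq> S" "card A = k - 2" "P \<subseteq> S - A" "card P = t + 2"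
  shows "(\<Sum>x\<in>P. f A x * (\<Prod>u\<in>P - {x}. inverse (rows_det k (u # x # in_order ss A)))) = 0"
proof -
  let ?as = "in_order ss A"
  let ?ls = "map (\<lambda>a x. a \<bullet> x) (forms A)"
  have as: "set ?as = A" "distinct ?as" "length ?as + 2 = k"
    using assms dist k length_in_order[of ss A] by auto
  note F = formsD[OF assms(1,2)]
  have zero: "rows_det k (u # v # ?as) = 0 \<longleftrightarrow> u = v" if "u \<in> P" "v \<in> P" for u v
    using that as assms by (subst rows_det_zero_iff) auto
  have "(\<Sum>x\<in>P. (\<Prod>l\<leftarrow>?ls. l x) * (\<Prod>y\<in>P - {x}. inverse (rows_det k (y # x # ?as)))) = 0"
  proof (rule bracket_interpolation)
    show "card P = length ?ls + 2" using F(1) assms by simp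
    fix x y
    show "rows_det k (y # x # ?as) = - rows_det k (x # y # ?as)"
      using rows_det_swap[of "[]" ?as k y x] as by simp
    assume xy: "x \<in> P" "y \<in> P"
    show "rows_det k (x # y # ?as) \<noteq> 0" if "x \<noteq> y" using zero[OF xy] that by simp
  next
    fix x assume "x \<in> P"
    then show "rows_det k (x # x # ?as) = 0" using zero by blast
  next
    fix l a b x assume l: "l \<in> set ?ls" and abx: "a \<in> P" "b \<in> P" "x \<in> P" "a \<noteq> b"
    then obtain c where c: "c \<in> set (forms A)" "l = (\<lambda>x. c \<bullet> x)" by auto
    have cz: "c \<bullet> u = 0" if "u \<in> set ?as" for u using that F(4) c assms(1) as(1) by blast
    have car: "c \<in> carrier_vec k" "set ?as \<subseteq> carrier_vec k" "a \<in> carrier_vec k"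
        "b \<in> carrier_vec k" "x \<in> carrier_vec k"
      using c F(3) as(1) assms(1,3) abx S_carrier by blast+
    show "l x * rows_det k (a # b # ?as) =
        l a * rows_det k (x # b # ?as) - l b * rows_det k (x # a # ?as)"
      unfolding c(2) using zero abx as(3) car cz by (intro rows_det_three_term) auto
  qed
  then show ?thesis by (simp add: tangent_fun_def comp_def)
qed

text \<open>For fixed A the potential at A + x is a constant times \<open>g A x\<close>, so the
  claim is the interpolation of \<open>f A\<close> once the signs have cancelled.\<close>

lemma potential_tangent_relation:
  assumes "exchange_potential S (k - 2) g p"
  shows "tangent_relation k t ss p"
  unfolding tangent_relation_def
proof (intro allI impI)
  fix A E' assume *: "E' \<subseteq> S \<and> card E' = k + t \<and> A \<subseteq> E' \<and> card A = k - 2"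
  note p = exchange_potentialD[OF assms]
  have A: "A \<subseteq> S" "card A = k - 2" using * by auto
  have finA: "finite A" using A(1) by (rule finite_subset) simp
  let ?P = "E' - A"
  have P: "?P \<subseteq> S - A" "card ?P = t + 2"
    using * k finA by (auto simp: card_Diff_subset)
  have "?P \<noteq> {}"
  proof
    assume "?P = {}"
    then have "card ?P = 0" by (simp only: card.empty)
    then show False using P(2) by simp
  qed
  then obtain x0 where x0: "x0 \<in> ?P" by blast
  define \<kappa> where "\<kappa> = p (insert x0 A) / g A x0"
  have x0g: "g A x0 \<noteq> 0" using x0 P A g_nonzero by blast
  have term_eq: "p (insert x A) * (\<Prod>u\<in>E' - insert x A. inverse (rows_det k (u # in_order ss (insert x A)))) =
      \<kappa> * (f A x * (\<Prod>u\<in>?P - {x}. inverse (rows_det k (u # x # in_order ss A))))" if x: "x \<in> ?P" for x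
  proof -
    have xS: "x \<in> S" "x \<notin> A" using x P by auto
    have "p (insert x A) * g A x0 = p (insert x0 A) * g A x"
      using x x0 P A by (intro p(2)) auto
    then have px: "p (insert x A) = \<kappa> * g A x" using x0g by (simp add: \<kappa>_def field_simps)
    \<comment> \<open>Sorting \<open>x\<close> into A changes each of these t + 1 determinants by
      the same sign, which produces the exponent used in \<open>g\<close>.\<close>
    have cardP: "card (?P - {x}) = t + 1" using x P by simp
    have "E' - insert x A = ?P - {x}" by auto
    then have "(\<Prod>u\<in>E' - insert x A. inverse (rows_det k (u # in_order ss (insert x A)))) =
        (\<Prod>u\<in>?P - {x}. inverse ((-1) ^ sg A x * rows_det k (u # x # in_order ss A)))"
      using rows_det_in_order_insert[of ss x A k] dist xS A k by (simp add: sg_def)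
    also have "\<dots> = (\<Prod>u\<in>?P - {x}. (-1) ^ sg A x * inverse (rows_det k (u # x # in_order ss A)))"
      by (simp add: power_inverse[symmetric])
    also have "\<dots> = ((-1) ^ sg A x) ^ (t + 1) *
        (\<Prod>u\<in>?P - {x}. inverse (rows_det k (u # x # in_order ss A)))"
      unfolding prod.distrib prod_constant cardP by simp
    finally have eq: "(\<Prod>u\<in>E' - insert x A. inverse (rows_det k (u # in_order ss (insert x A)))) =
      (-1) ^ ((t + 1) * sg A x) * (\<Prod>u\<in>?P - {x}. inverse (rows_det k (u # x # in_order ss A)))"
      by (simp only: power_mult[symmetric] mult.commute[of "sg A x"])
    have "(-1) ^ ((t + 1) * sg A x) * (-1) ^ ((t + 1) * sg A x) = (1 :: 'a)"
      by (simp add: power_add[symmetric])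
    then show ?thesis unfolding eq px g_def by (simp add: mult_ac)
  qed
  have "(\<Sum>x\<in>?P. p (insert x A) *
      (\<Prod>u\<in>E' - insert x A. inverse (rows_det k (u # in_order ss (insert x A))))) =
    \<kappa> * (\<Sum>x\<in>?P. f A x * (\<Prod>u\<in>?P - {x}. inverse (rows_det k (u # x # in_order ss A))))"
    unfolding sum_distrib_left using term_eq by (intro sum.cong) auto
  also have "\<dots> = 0" using tangent_interpolation[OF A P] by simp
  finally show "(\<Sum>x\<in>?P. p (insert x A) *
      (\<Prod>u\<in>E' - insert x A. inverse (rows_det k (u # in_order ss (insert x A))))) = 0" .
qed

text \<open>The defining product of \<open>alpha_coeff\<close> telescopes along the sets \<open>A i\<close>, which exchange
  \<open>F\<close> for \<open>C\<close> one vector at a time.\<close>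
lemma alpha_coeff_square:
  assumes pot: "exchange_potential S (k - 2) g p" and large: "k \<le> card S"
  shows "\<exists>\<kappa>. \<kappa> \<noteq> 0 \<and> (\<forall>C\<subseteq>S. card C = k - 1 \<longrightarrow> (alpha_coeff k t ss forms C)\<^sup>2 = (\<kappa> * p C)\<^sup>2)"
proof -
  note p = exchange_potentialD[OF pot]
  define F where "F = set (take (k - 2) ss)"
  have len: "length ss = card S" using dist by (simp add: distinct_card)
  have F: "F \<subseteq> S" "card F = k - 2"
    unfolding F_def using dist len large by (auto simp: distinct_card dest: in_set_takeD)
  have finF: "finite F" by (simp add: F_def)
  have "card (S - F) > 0" using F finF large k by (simp add: card_Diff_subset)
  then obtain x0 where x0: "x0 \<in> S - F" by (metis card_gt_0_iff ex_in_conv)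
  \<comment> \<open>Scales \<open>p\<close> to agree with \<open>g F\<close> on the sets F + x, the
    starting point of the telescoping product.\<close>
  define \<kappa> where "\<kappa> = g F x0 / p (insert x0 F)"
  have p0: "p (insert x0 F) \<noteq> 0" using x0 F finF k by (intro p(1)) auto
  have \<kappa>0: "\<kappa> \<noteq> 0" using p0 g_nonzero[OF F x0] by (simp add: \<kappa>_def)
  have start: "g F x = \<kappa> * p (insert x F)" if "x \<in> S - F" for x
  proof -
    have "p (insert x F) * g F x0 = p (insert x0 F) * g F x" using F that x0 by (rule p(2))
    then show ?thesis using p0 by (simp add: \<kappa>_def field_simps)
  qed
  have "(alpha_coeff k t ss forms C)\<^sup>2 = (\<kappa> * p C)\<^sup>2" if C: "C \<subseteq> S" "card C = k - 1" for C
  proof -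
    define D xs zs r where "D = C \<inter> F" and "xs = in_order ss (C - F)"
      and "zs = in_order ss (F - C)" and "r = length zs"
    have finC: "finite C" using C(1) by (rule finite_subset) simp
    have xs: "set xs = C - F" "distinct xs" and zs: "set zs = F - C" "distinct zs"
      unfolding xs_def zs_def using C F dist by auto
    have lx: "length xs = card (C - F)" and lz: "r = card (F - C)"
      unfolding xs_def zs_def r_def using C F dist length_in_order by blast+
    have cC: "card D + length xs = k - 1"
      unfolding lx D_def using C finC card_Int_Diff[of C F] by simp
    have cF: "card D + r = k - 2"
      unfolding lz D_def using F finF card_Int_Diff[of F C] by (simp add: Int_commute)
    \<comment> \<open>|C| = |F| + 1, so one element of C is left over; counted from 0 it is
      \<open>xs ! r\<close>.\<close>
    have lxr: "length xs = Suc r" using cC cF k by simp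
    define A where "A = (\<lambda>i. D \<union> set (drop i zs) \<union> set (take i xs))"
    have AS: "A i \<subseteq> S" for i
      using C F xs zs by (auto simp: A_def D_def dest: in_set_takeD in_set_dropD)
    have Acard: "card (A i) = k - 2" if "i \<le> r" for i
    proof -
      have "card (A i) = card (D \<union> set (drop i zs)) + card (set (take i xs))"
        unfolding A_def using finF xs zs
        by (intro card_Un_disjoint) (auto simp: D_def dest: in_set_takeD in_set_dropD)
      also have "card (D \<union> set (drop i zs)) = card D + card (set (drop i zs))"
        using finF zs by (intro card_Un_disjoint) (auto simp: D_def dest: in_set_dropD)
      also have "card (set (drop i zs)) = r - i" using zs by (simp add: distinct_card r_def)
      also have "card (set (take i xs)) = i" using xs that lxr by (simp add: distinct_card)
      finally show ?thesis using cF that by simp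
    qed
    have xA: "xs ! i \<in> S - A i" if "i \<le> r" for i
    proof -
      have i: "i < length xs" using that lxr by simp
      then have "xs ! i \<in> C - F" using xs nth_mem by blast
      moreover have "xs ! i \<notin> set (take i xs)"
        using xs(2) i by (metis id_take_nth_drop distinct_append disjoint_insert(2) list.simps(15))
      ultimately show ?thesis
        using C zs by (auto simp: A_def D_def dest: in_set_dropD)
    qed
    have zA: "zs ! i \<in> S - A (Suc i)" if "i < r" for i
    proof -
      have i: "i < length zs" using that by (simp add: r_def)
      then have "zs ! i \<in> F - C" using zs nth_mem by blast
      moreover have "zs ! i \<notin> set (drop (Suc i) zs)"
        using zs(2) i by (metis Cons_nth_drop_Suc distinct.simps(2) distinct_drop)
      ultimately show ?thesis
        using F xs by (auto simp: A_def D_def dest: in_set_takeD)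
    qed
    have exch: "insert (xs ! i) (A i) = insert (zs ! i) (A (Suc i))" if "i < r" for i
    proof -
      have "set (take (Suc i) xs) = insert (xs ! i) (set (take i xs))"
        using that lxr by (simp add: take_Suc_conv_app_nth)
      moreover have "set (drop i zs) = insert (zs ! i) (set (drop (Suc i) zs))"
        using that by (simp add: r_def flip: Cons_nth_drop_Suc)
      ultimately show ?thesis by (auto simp: A_def)
    qed
    have A0: "A 0 = F" using zs by (auto simp: A_def D_def)
    \<comment> \<open>The partial product up to j is the scaled potential at A_j + x_j. That set is
      also A_(j+1) + z_j, so the next quotient is one exchange at A_(j+1).\<close>
    have tele: "g (A j) (xs ! j) * (\<Prod>i = 1..j. g (A (i - 1)) (xs ! (i - 1)) / g (A i) (zs ! (i - 1)))
        = \<kappa> * p (insert (xs ! j) (A j))" if "j \<le> r" for j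
      using that
    proof (induction j)
      case 0
      then show ?case using start xA[of 0] A0 by simp
    next
      case (Suc j)
      let ?\<Pi> = "\<Prod>i = 1..j. g (A (i - 1)) (xs ! (i - 1)) / g (A i) (zs ! (i - 1))"
      have j: "j < r" "Suc j \<le> r" using Suc.prems by auto
      have nz: "g (A (Suc j)) (zs ! j) \<noteq> 0"
        using g_nonzero[OF AS Acard[OF j(2)] zA[OF j(1)]] .
      have "g (A (Suc j)) (xs ! Suc j) *
          (\<Prod>i = 1..Suc j. g (A (i - 1)) (xs ! (i - 1)) / g (A i) (zs ! (i - 1))) =
        (g (A j) (xs ! j) * ?\<Pi>) * g (A (Suc j)) (xs ! Suc j) / g (A (Suc j)) (zs ! j)"
        by (simp add: prod.atLeast_Suc_atMost_Suc_shift prod.cl_ivl_Suc)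
      also have "g (A j) (xs ! j) * ?\<Pi> = \<kappa> * p (insert (zs ! j) (A (Suc j)))"
        using Suc.IH j exch[OF j(1)] by simp
      also have "\<kappa> * p (insert (zs ! j) (A (Suc j))) * g (A (Suc j)) (xs ! Suc j) =
        \<kappa> * (p (insert (xs ! Suc j) (A (Suc j))) * g (A (Suc j)) (zs ! j))"
        using p(2)[OF AS Acard[OF j(2)] zA[OF j(1)] xA[OF j(2)]] by simp
      finally show ?case using nz by simp
    qed
    have Ar: "A r = D \<union> set (take r xs)" by (simp add: A_def r_def)
    have "insert (xs ! r) (A r) = C"
    proof -
      have "take (Suc r) xs = xs" using lxr by simp
      then have "set xs = insert (xs ! r) (set (take r xs))"
        using lxr by (metis list.simps(15) rotate1.simps(2) set_rotate1 take_Suc_conv_app_nth lessI)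
      then show ?thesis using xs by (auto simp: Ar D_def)
    qed
    then have "\<kappa> * p C = g (A r) (xs ! r) * (\<Prod>i = 1..r. g (A (i - 1)) (xs ! (i - 1)) / g (A i) (zs ! (i - 1)))"
      using tele[of r] by simp
    \<comment> \<open>Squaring turns every \<open>g\<close> into \<open>f\<close> and absorbs the
      sign in front of the product.\<close>
    then have "(\<kappa> * p C)\<^sup>2 = (f (A r) (xs ! r))\<^sup>2 *
      (\<Prod>i = 1..r. (f (A (i - 1)) (xs ! (i - 1)))\<^sup>2 / (f (A i) (zs ! (i - 1)))\<^sup>2)"
      by (simp add: power_mult_distrib prod_power_distrib power_divide g_square)
    also have "\<dots> = (alpha_coeff k t ss forms C)\<^sup>2"
      unfolding alpha_coeff_def Let_def F_def[symmetric] D_def[symmetric] xs_def[symmetric]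
        zs_def[symmetric] r_def[symmetric] Ar
      by (simp add: power_mult_distrib prod_power_distrib power_divide A_def
          flip: power_mult)
    finally show ?thesis by simp
  qed
  then show ?thesis using \<kappa>0 by blast
qed

lemma alpha_coeff_tangent_relation:
  assumes "k \<le> card S"
  shows "\<exists>p. (\<forall>C\<subseteq>S. card C = k - 1 \<longrightarrow> p C \<noteq> 0 \<and> (alpha_coeff k t ss forms C)\<^sup>2 = (p C)\<^sup>2) \<and>
    tangent_relation k t ss p"
proof -
  obtain p where p: "exchange_potential S (k - 2) g p" using potential_exists by blast
  obtain \<kappa> where \<kappa>: "\<kappa> \<noteq> 0"
    "\<And>C. C \<subseteq> S \<Longrightarrow> card C = k - 1 \<Longrightarrow> (alpha_coeff k t ss forms C)\<^sup>2 = (\<kappa> * p C)\<^sup>2"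
    using alpha_coeff_square[OF p assms] by blast
  \<comment> \<open>The exchange condition is homogeneous, so the scalar is absorbed into the
    potential.\<close>
  have "exchange_potential S (k - 2) g (\<lambda>C. \<kappa> * p C)"
    using p \<kappa>(1) by (auto simp: exchange_potential_def)
  note q = exchange_potentialD(1)[OF this] potential_tangent_relation[OF this]
  show ?thesis
    using q \<kappa>(2) k by (intro exI[of _ "\<lambda>C. \<kappa> * p C"]) auto
qed

end

section \<open>From proportional squared coefficients to proportional polynomials\<close>

lemma Yconst_mult: "Yconst (a * b) = Yconst a * Yconst b"
  by (simp add: Yconst_def mult_single)

lemma phi_proportional:
  fixes ss ss' :: "'a::{field, finite} vec list"
  assumes "finite E" "length ss = length ss'" "t = CARD('a) + k - 1 - length ss" "c \<noteq> 0"
    and order: "\<And>C. C \<subseteq> E \<Longrightarrow> in_order ss C = in_order ss' C"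
    and coeff: "\<And>C. C \<subseteq> E \<Longrightarrow> card C = k - 1 \<Longrightarrow>
      (alpha_coeff k t ss forms C)\<^sup>2 = (c * alpha_coeff k t ss' forms' C)\<^sup>2"
  shows "\<exists>d. d \<noteq> 0 \<and> phi k E ss forms = Yconst d * phi k E ss' forms'"
proof -
  define d where "d = (if even CARD('a) then c else c\<^sup>2)"
  define e where "e = (\<lambda>a :: 'a. if even CARD('a) then a else a\<^sup>2)"
  have e: "e (alpha_coeff k t ss forms C) = d * e (alpha_coeff k t ss' forms' C)"
    if C: "C \<subseteq> E" "card C = k - 1" for C
  proof (cases "even CARD('a)")
    case True
    \<comment> \<open>For even q the exponent in (-1)^(q-1) = 1 is odd, so -1 = 1 and equal squares
      have equal roots.\<close>
    have "CARD('a) \<noteq> 0" by simp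
    then have "odd (CARD('a) - 1)" using True by simp
    then have "(-1 :: 'a) = 1" using minus_one_power_card_field[where 'a = 'a] by simp
    then have "- a = a" for a :: 'a by (metis mult_1 mult_minus_left)
    then have "alpha_coeff k t ss forms C = c * alpha_coeff k t ss' forms' C"
      using coeff[OF C] unfolding power2_eq_iff by metis
    then show ?thesis using True by (simp add: d_def e_def)
  qed (use coeff[OF C] in \<open>simp add: d_def e_def power_mult_distrib\<close>)
  have "phi k E ss forms = (\<Sum>C | C \<subseteq> E \<and> card C = k - 1. Yconst (e (alpha_coeff k t ss forms C)) *
      (\<Prod>z\<in>E - C. Yconst (1 / rows_det k (z # in_order ss C)) * Ydet k z))"
    by (simp add: phi_def Let_def e_def assms(3))
  also have "\<dots> = (\<Sum>C | C \<subseteq> E \<and> card C = k - 1. Yconst d * (Yconst (e (alpha_coeff k t ss' forms' C)) *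
      (\<Prod>z\<in>E - C. Yconst (1 / rows_det k (z # in_order ss' C)) * Ydet k z)))"
    by (intro sum.cong) (auto simp: e order Yconst_mult mult.assoc)
  also have "\<dots> = Yconst d * phi k E ss' forms'"
    using assms(2,3) by (simp add: phi_def Let_def e_def sum_distrib_left)
  finally show ?thesis using assms(4) by (intro exI[of _ d]) (simp add: d_def)
qed

theorem theorem1p4:
  fixes G E S S' :: "'a::{field, finite} vec set"
    and gs ss ss' :: "'a vec list"
    and forms forms' :: "'a vec set \<Rightarrow> 'a vec list"
    and q k n t :: nat
  assumes q: "q = CARD('a)"
    and k: "k \<ge> 3"
    and G: "arc k G" "ordering_of G gs"
    and n: "n + k \<le> card G"
    and t: "t = card G - k - n"
    and W: "property_W k gs n"
    and n_odd: "odd q \<Longrightarrow> 2 * int n \<ge> int (card G) - int k - 1"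
    and E: "E \<subseteq> G" "card E = (if even q then k + t - 1 else k + 2 * t - 1)"
    and S: "arc k S" "G \<subseteq> S"
      "int (card S) = int q + 2 * int k + int n - 1 - int (card G)"
      "ordering_of S ss" "prefix gs ss" "tangent_forms k (q + k - 1 - card S) S forms"
    and S': "arc k S'" "G \<subseteq> S'"
      "int (card S') = int q + 2 * int k + int n - 1 - int (card G)"
      "ordering_of S' ss'" "prefix gs ss'" "tangent_forms k (q + k - 1 - card S') S' forms'"
  shows "\<exists>c::'a. c \<noteq> 0 \<and> phi k E ss forms = Yconst c * phi k E ss' forms'"
proof -
  have ss: "distinct ss" "set ss = S" and ss': "distinct ss'" "set ss' = S'"
    and gs: "distinct gs" "set gs = G"
    using S(4) S'(4) G(2) by (simp_all add: ordering_of_def)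
  \<comment> \<open>Substituting t = |G| - k - n into the prescribed size gives |S| = q + k - 1 - t,
    so t is the number of tangents in the construction.\<close>
  have cards: "card S + t + 1 = q + k" "card S' + t + 1 = q + k"
    using S(3) S'(3) t n by linarith+
  then have tS: "q + k - 1 - card S = t" "q + k - 1 - card S' = t" by linarith+
  interpret T: arc_tangents k t ss forms
    by unfold_locales (use k S(1,6) ss cards tS q in simp_all)
  interpret T': arc_tangents k t ss' forms'
    by unfold_locales (use k S'(1,6) ss' cards tS q in simp_all)
  have fin: "finite S" "finite S'" using ss(2) ss'(2) by auto
  \<comment> \<open>Guarantees that the first k - 2 points exist and that S has a point outside
    them.\<close>
  have large: "k \<le> card (set ss)" "k \<le> card (set ss')"
    using card_mono[OF fin(1) S(2)] card_mono[OF fin(2) S'(2)] n unfolding ss(2) ss'(2)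
    by linarith+
  obtain p where p: "\<And>C. C \<subseteq> S \<Longrightarrow> card C = k - 1 \<Longrightarrow>
      p C \<noteq> 0 \<and> (alpha_coeff k t ss forms C)\<^sup>2 = (p C)\<^sup>2"
    "tangent_relation k t ss p"
    using T.alpha_coeff_tangent_relation[OF large(1)] unfolding ss(2) by blast
  obtain p' where p': "\<And>C. C \<subseteq> S' \<Longrightarrow> card C = k - 1 \<Longrightarrow>
      p' C \<noteq> 0 \<and> (alpha_coeff k t ss' forms' C)\<^sup>2 = (p' C)\<^sup>2"
    "tangent_relation k t ss' p'"
    using T'.alpha_coeff_tangent_relation[OF large(2)] unfolding ss'(2) by blast
  have "\<exists>c. c \<noteq> 0 \<and> (\<forall>C\<in>M_rows k (set gs). p C = c * p' C)"
  proof (rule tangent_relation_unique)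
    show "arc k (set gs)" "k + t + n = card (set gs)" "2 \<le> k" using G gs t n k by simp_all
    show "tangent_relation k t gs p" "tangent_relation k t gs p'"
      using p(2) p'(2) S(5) S'(5) ss(1) ss'(1) k by (auto intro: tangent_relation_prefix)
    fix C assume "C \<in> M_rows k (set gs)"
    then have C: "C \<subseteq> S" "C \<subseteq> S'" "card C = k - 1"
      using gs(2) S(2) S'(2) by (auto simp: M_rows_def)
    then show "p C \<noteq> 0 \<and> p' C \<noteq> 0" using p(1) p'(1) by blast
  qed (rule gs W)+
  then obtain c where c: "c \<noteq> 0" "\<And>C. C \<subseteq> G \<Longrightarrow> card C = k - 1 \<Longrightarrow> p C = c * p' C"
    unfolding gs(2) M_rows_def by blast
  show ?thesis
  proof (rule phi_proportional[where t = t and c = c])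
    have "finite G" using S(2) fin(1) by (rule finite_subset)
    show "finite E" using E(1) \<open>finite G\<close> by (rule finite_subset)
    have len: "length ss = card S" "length ss' = card S'"
      using ss ss' distinct_card by metis+
    show "length ss = length ss'" "t = CARD('a) + k - 1 - length ss"
      using cards q unfolding len by linarith+
    fix C assume C: "C \<subseteq> E"
    then have CG: "C \<subseteq> G" "C \<subseteq> S" "C \<subseteq> S'" using E(1) S(2) S'(2) by auto
    show "in_order ss C = in_order ss' C"
      using in_order_prefix[OF S(5) ss(1), of C] in_order_prefix[OF S'(5) ss'(1), of C] CG gs
      by simp
    assume card: "card C = k - 1"
    show "(alpha_coeff k t ss forms C)\<^sup>2 = (c * alpha_coeff k t ss' forms' C)\<^sup>2"
      using p(1)[OF CG(2) card] p'(1)[OF CG(3) card] c(2)[OF CG(1) card]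
      by (simp add: power_mult_distrib)
  qed (rule c)
qed

end
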